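(* Let $\chi$ be a convex increasing function on $\mathbb{R}$ with $\lim_{t\to-\infty}\chi'(t)=C_0>0$. Let $\varphi$ be a plurisubharmonic function near the origin $o\in\mathbb{C}^n$ with $C_0\cdot\nu(\varphi,o)\ge n$, and let $\varphi_A\in\mathcal{E}(\mathbb{C}^n)$ be a plurisubharmonic function on $\mathbb{C}^n$ with generalized analytic singularities. If $e^{-2\chi\circ\varphi}-e^{-2\varphi_A}$ is locally integrable near $o$, then $\lim_{t\to-\infty}|\chi(t)-C_0t|<\infty$.
   Context: $\nu(\varphi,o)$ denotes the Lelong number of $\varphi$ at $o$. The function $\chi$ is extended by $\chi(-\infty)=\lim_{t\to-\infty}\chi(t)$ so that $\chi\circ\varphi$ makes sense. Local integrability is with respect to Lebesgue measure. A (pluri)subharmonic function $\varphi$ has analytic singularities if locally it can be written as $\varphi=\frac{c}{2}\log\big(\sum_{k=1}^{m}|f_k|^2\big)+O(1)$ with $c\in\mathbb{R}^+$ and $f_k$ holomorphic functions (the $f_k$ may all vanish identically, so that a restriction of a function to a line that is identically $-\infty$ is allowed below). A plurisubharmonic function $\varphi$ on a complex manifold $X$ has generalized analytic singularities if for any point $x_0\in X$ there exists a ball $B_r(x_0)$ such that for every complex line $L\subset B_r(x_0)$ (i.e. the intersection of an affine complex line with the ball), $\varphi|_L$ has analytic singularities. The set of plurisubharmonic functions on $X$ with generalized analytic singularities is denoted $\mathcal{E}(X)$. *)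

theory Defs
  imports "HOL-Analysis.Analysis"
begin

text \<open>Functions with values in \<open>[-\<infinity>, \<infinity>)\<close> are modelled as total \<open>ereal\<close>-valued
  functions; their values outside the open set under consideration are irrelevant.\<close>

definition ereal_exp :: "ereal \<Rightarrow> ereal" where
  "ereal_exp x = (if x = -\<infinity> then 0 else if x = \<infinity> then \<infinity> else ereal (exp (real_of_ereal x)))"

definition ereal_log :: "real \<Rightarrow> ereal" where
  "ereal_log x = (if x \<le> 0 then -\<infinity> else ereal (ln x))"

definition usc_on :: "'a::topological_space set \<Rightarrow> ('a \<Rightarrow> ereal) \<Rightarrow> bool" where
  "usc_on U u \<longleftrightarrow> (\<forall>c. openin (top_of_set U) {z \<in> U. u z < c})"

text \<open>The mean value over the circle of radius \<open>r\<close> about \<open>c\<close>, as positive minus negative part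
  (\<open>e2ennreal x\<close> is \<open>max 0 x\<close>). For an upper semicontinuous function with values
  below \<open>\<infinity>\<close> the positive part has finite integral, so the difference is meaningful and may be
  \<open>-\<infinity>\<close>.\<close>

definition circle_mean :: "(complex \<Rightarrow> ereal) \<Rightarrow> complex \<Rightarrow> real \<Rightarrow> ereal" where
  "circle_mean u c r =
     (enn2ereal (\<integral>\<^sup>+ t \<in> {0..2*pi}. e2ennreal (u (c + of_real r * cis t)) \<partial>lborel)
      - enn2ereal (\<integral>\<^sup>+ t \<in> {0..2*pi}. e2ennreal (- u (c + of_real r * cis t)) \<partial>lborel))
     / ereal (2 * pi)"

text \<open>The function \<open>-\<infinity>\<close> is admitted here (it can arise as a restriction to a line), but it is
  excluded on every connected component in the definition of plurisubharmonicity below.\<close>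

definition subharmonic_on :: "complex set \<Rightarrow> (complex \<Rightarrow> ereal) \<Rightarrow> bool" where
  "subharmonic_on S u \<longleftrightarrow>
     usc_on S u \<and> (\<forall>z\<in>S. u z \<noteq> \<infinity>) \<and>
     (\<forall>c r. 0 < r \<and> cball c r \<subseteq> S \<longrightarrow> u c \<le> circle_mean u c r)"

definition line_param :: "complex ^ 'n \<Rightarrow> complex ^ 'n \<Rightarrow> complex \<Rightarrow> complex ^ 'n" where
  "line_param a b w = a + w *s b"

definition psh_on :: "(complex ^ 'n) set \<Rightarrow> (complex ^ 'n \<Rightarrow> ereal) \<Rightarrow> bool" where
  "psh_on U u \<longleftrightarrow>
     usc_on U u \<and> (\<forall>z\<in>U. u z \<noteq> \<infinity>) \<and>
     (\<forall>a b. b \<noteq> 0 \<longrightarrow> subharmonic_on (line_param a b -` U) (u \<circ> line_param a b)) \<and>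
     (\<forall>C \<in> components U. \<exists>z\<in>C. u z \<noteq> -\<infinity>)"

definition lelong_number :: "(complex ^ 'n \<Rightarrow> ereal) \<Rightarrow> complex ^ 'n \<Rightarrow> ereal" where
  "lelong_number u p = Liminf (at p) (\<lambda>z. u z / ereal (ln (norm (z - p))))"

text \<open>The two inequalities say that the two sides have the same \<open>-\<infinity>\<close> set near \<open>p\<close> and
  differ by a bounded function off it. Since \<open>c\<close> is positive and the \<open>f k\<close> may all vanish,
  the identically \<open>-\<infinity>\<close> function is included.\<close>

definition analytic_singularities_on :: "complex set \<Rightarrow> (complex \<Rightarrow> ereal) \<Rightarrow> bool" where
  "analytic_singularities_on S u \<longleftrightarrow>
     subharmonic_on S u \<and>
     (\<forall>p\<in>S. \<exists>W (c::real) (m::nat) (f :: nat \<Rightarrow> complex \<Rightarrow> complex) (M::real).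
        open W \<and> p \<in> W \<and> W \<subseteq> S \<and> 0 < c \<and> 1 \<le> m \<and> (\<forall>k\<in>{1..m}. f k holomorphic_on W) \<and>
        (\<forall>z\<in>W.
           u z \<le> ereal (c / 2) * ereal_log (\<Sum>k=1..m. (cmod (f k z))\<^sup>2) + ereal M \<and>
           ereal (c / 2) * ereal_log (\<Sum>k=1..m. (cmod (f k z))\<^sup>2) \<le> u z + ereal M))"

text \<open>Complex lines in a ball are parametrised as \<open>w \<mapsto> a + w b\<close> with \<open>b \<noteq> 0\<close>, where \<open>w\<close> ranges
  over the parameters for which the point lies in the ball.\<close>

definition gen_analytic_psh :: "(complex ^ 'n) set \<Rightarrow> (complex ^ 'n \<Rightarrow> ereal) set" where
  "gen_analytic_psh X =
     {u. psh_on X u \<and>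
         (\<forall>x\<in>X. \<exists>r>0. ball x r \<subseteq> X \<and>
            (\<forall>a b. b \<noteq> 0 \<longrightarrow>
               analytic_singularities_on (line_param a b -` ball x r) (u \<circ> line_param a b)))}"

text \<open>The value at \<open>-\<infinity>\<close> is the limit there; the value chosen at \<open>\<infinity>\<close> is never used.\<close>

definition extend_minf :: "(real \<Rightarrow> real) \<Rightarrow> ereal \<Rightarrow> ereal" where
  "extend_minf g x =
     (if x = -\<infinity> then Lim at_bot (\<lambda>t. ereal (g t))
      else if x = \<infinity> then \<infinity> else ereal (g (real_of_ereal x)))"

text \<open>A convex function on the line is differentiable outside a countable set; the limit of its
  derivative is taken along the points of differentiability.\<close>

definition deriv_tendsto_at_bot :: "(real \<Rightarrow> real) \<Rightarrow> real \<Rightarrow> bool" where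
  "deriv_tendsto_at_bot g C \<longleftrightarrow>
     (deriv g \<longlongrightarrow> C) (inf at_bot (principal {t. g differentiable (at t)}))"

text \<open>Local integrability near \<open>p\<close> amounts to integrability over some neighbourhood of \<open>p\<close>.
  In \<open>ereal\<close>, \<open>\<infinity> - \<infinity> = \<infinity>\<close>; for a difference of two functions that are finite almost
  everywhere this convention is immaterial.\<close>

definition locally_integrable_near :: "('a::euclidean_space \<Rightarrow> ereal) \<Rightarrow> 'a \<Rightarrow> bool" where
  "locally_integrable_near f p \<longleftrightarrow>
     (\<exists>V. open V \<and> p \<in> V \<and> f \<in> borel_measurable (lebesgue_on V) \<and>
          (\<integral>\<^sup>+ z. e2ennreal \<bar>f z\<bar> \<partial>lebesgue_on V) < \<infinity>)"

end

theory Submission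
  imports Defs "HOL-Complex_Analysis.Complex_Analysis"
begin

text \<open>Put \<open>h t = g t - C0 * t\<close>. The slopes of \<open>g\<close> decrease to \<open>C0\<close> at \<open>-\<infinity>\<close>, so \<open>h\<close> is nondecreasing; if
  it is bounded below, it has a finite limit at \<open>-\<infinity>\<close> and the claim follows. It remains to refute
  \<open>h \<rightarrow> -\<infinity>\<close>. Let \<open>F = \<bar>exp (-2 g(\<phi>)) - exp (-2 \<phi>A)\<bar>\<close> and let \<open>n\<close> be the dimension.

  Averaging over the complex lines through the origin yields a vector \<open>b \<noteq> 0\<close> for which
  \<open>F (w b) \<bar>w\<bar>^(2n-2)\<close> is integrable near \<open>w = 0\<close> (\<open>exists_line_finite_weighted_integral\<close>). On this
  line \<open>\<phi>A\<close> either is \<open>-\<infinity>\<close> near the origin, which makes \<open>F\<close> infinite there, or has the form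
  \<open>a ln \<bar>w\<bar> + O(1)\<close> (\<open>analytic_singularity_log_form\<close>). Let \<open>u\<close> be the restriction of \<open>\<phi>\<close>, and
  \<open>B = max a n\<close>. The core of the proof is the sharp upper bound \<open>u \<le> (B / C0) ln \<bar>w\<bar> + O(1)\<close>. It gives
  \<open>g(u) \<le> B ln \<bar>w\<bar> + O(1) + h (\<dots>)\<close>, where the last term tends to \<open>-\<infinity>\<close>, so \<open>exp (-2 g(u))\<close> dominates
  both \<open>\<bar>w\<bar>^(-2B)\<close> and \<open>exp (-2 \<phi>A)\<close>. The weighted integrand then is at least a multiple of \<open>\<bar>w\<bar>^(-2)\<close>,
  which is not integrable in the plane.

  For the sharp bound it suffices that \<open>u \<le> (B / C0 - \<epsilon>) ln \<bar>w\<bar>\<close> near the origin for every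
  \<open>\<epsilon> > 0\<close>: a maximum principle with a negligible singularity at the origin removes the loss
  (\<open>removable_log_bound\<close>). If \<open>a \<le> n\<close>, the lossy bound is the hypothesis on the Lelong number. If
  \<open>a > n\<close>, consider the points where it fails. There \<open>exp (-2 g(u))\<close> is negligible against
  \<open>exp (-2 \<phi>A)\<close>, because \<open>g\<close> has slope close to \<open>C0\<close> far to the left; so the weighted integrand is
  at least a multiple of \<open>\<bar>w\<bar>^(-2)\<close> on this exceptional set, which must therefore have density zero
  at the origin. The mean value inequality over the discs of radius \<open>\<bar>w\<bar> / 2\<close> about \<open>w\<close> then carries the
  bound over from the complement to every point (\<open>subharmonic_log_bound_off_sparse_set\<close>).\<close>

section \<open>Convex functions near minus infinity\<close>

lemma convex_subgradient_exists:
  fixes g :: "real \<Rightarrow> real"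
  assumes "convex_on UNIV g"
  shows "\<exists>m. \<forall>x y. g x + m x * (y - x) \<le> g y"
proof (intro exI allI)
  fix x y
  show "g x + Inf ((\<lambda>t. (g x - g t) / (x - t)) ` ({x<..} \<inter> UNIV)) * (y - x) \<le> g y"
    by (rule convex_le_Inf_differential[OF assms]) auto
qed

lemma subgradient_mono:
  fixes g :: "real \<Rightarrow> real"
  assumes sub: "\<And>x y. g x + m x * (y - x) \<le> g y"
  shows "mono m"
proof (rule monoI)
  fix x y :: real assume "x \<le> y"
  show "m x \<le> m y"
  proof (cases "x = y")
    case False
    then have "x < y" using \<open>x \<le> y\<close> by simp
    have "m x * (y - x) \<le> m y * (y - x)" using sub[of x y] sub[of y x] by (simp add: algebra_simps)
    then show ?thesis using \<open>x < y\<close> by simp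
  qed simp
qed

text \<open>The difference quotient at \<open>x\<close> always lies between \<open>m x\<close> and \<open>m y\<close>, so continuity of the
  subgradient squeezes it.\<close>

lemma subgradient_is_derivative:
  fixes g :: "real \<Rightarrow> real"
  assumes sub: "\<And>x y. g x + m x * (y - x) \<le> g y" and cont: "isCont m x"
  shows "(g has_real_derivative m x) (at x)"
proof -
  have lim: "((\<lambda>y. \<bar>m y - m x\<bar>) \<longlongrightarrow> 0) (at x)"
    using cont by (intro tendsto_rabs_zero) (simp add: isCont_def LIM_zero)
  have bound: "\<bar>(g y - g x) / (y - x) - m x\<bar> \<le> \<bar>m y - m x\<bar>" if "y \<noteq> x" for y
  proof -
    have 1: "m x * (y - x) \<le> g y - g x" "g y - g x \<le> m y * (y - x)"
      using sub[of x y] sub[of y x] by (simp_all add: algebra_simps)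
    show ?thesis
    proof (cases "x < y")
      case True
      then have "m x \<le> (g y - g x) / (y - x)" "(g y - g x) / (y - x) \<le> m y"
        using 1 by (simp_all add: pos_le_divide_eq pos_divide_le_eq)
      then show ?thesis by linarith
    next
      case False
      then have "y < x" using that by simp
      then have "m x \<ge> (g y - g x) / (y - x)" "(g y - g x) / (y - x) \<ge> m y"
        using 1 by (simp_all add: neg_le_divide_eq neg_divide_le_eq)
      then show ?thesis by linarith
    qed
  qed
  have "((\<lambda>y. (g y - g x) / (y - x) - m x) \<longlongrightarrow> 0) (at x)"
    by (rule Lim_null_comparison[OF _ lim]) (use bound in \<open>auto simp: eventually_at_filter\<close>)
  then show ?thesis
    by (simp add: has_field_derivative_iff LIM_zero_iff)
qed

text \<open>A subgradient is monotone, hence continuous off a countable set. So the filter along which the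
  derivative of \<open>g\<close> converges is not trivial, and properties along it hold at differentiability
  points arbitrarily far to the left.\<close>

lemma differentiable_points_unbounded_below:
  fixes g :: "real \<Rightarrow> real"
  assumes sub: "\<And>x y. g x + m x * (y - x) \<le> g y" and ev: "eventually P (inf at_bot (principal {t. g differentiable (at t)}))"
  obtains x where "x < y" "P x" "(g has_real_derivative m x) (at x)"
proof -
  obtain N where N: "\<And>x. x \<le> N \<Longrightarrow> g differentiable (at x) \<Longrightarrow> P x"
    using ev by (auto simp: eventually_inf_principal eventually_at_bot_linorder)
  let ?D = "{x. \<not> isCont m x}"
  have "countable ?D" by (rule mono_ctble_discont[OF subgradient_mono[OF sub]])
  moreover have "uncountable {min N y - 1 <..< min N y}" by (rule uncountable_open_interval[THEN iffD2]) linarith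
  ultimately obtain x where x: "x \<in> {min N y - 1 <..< min N y}" "isCont m x"
    using countable_subset[of "{min N y - 1 <..< min N y}" ?D] by blast
  have d: "(g has_real_derivative m x) (at x)" by (rule subgradient_is_derivative[OF sub x(2)])
  show ?thesis
  proof
    show "x < y" using x by simp
    show "P x" using N[of x] x d by (auto simp: real_differentiable_def)
  qed (rule d)
qed

lemma convex_minus_asymptote_mono:
  fixes g :: "real \<Rightarrow> real"
  assumes conv: "convex_on UNIV g" and lim: "deriv_tendsto_at_bot g C"
  shows "mono (\<lambda>t. g t - C * t)"
proof (rule monoI)
  fix x y :: real assume "x \<le> y"
  obtain m where sub: "\<And>x y. g x + m x * (y - x) \<le> g y" using convex_subgradient_exists[OF conv] by blast
  have "C \<le> m x"
  proof (rule ccontr)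
    assume "\<not> C \<le> m x"
    then have "eventually (\<lambda>t. deriv g t > m x) (inf at_bot (principal {t. g differentiable (at t)}))"
      using lim unfolding deriv_tendsto_at_bot_def by (auto intro: order_tendstoD)
    then obtain z where "z < x" "deriv g z > m x" "(g has_real_derivative m z) (at z)"
      by (rule differentiable_points_unbounded_below[OF sub])
    then show False using monoD[OF subgradient_mono[OF sub], of z x] DERIV_imp_deriv[of g "m z" z] by simp
  qed
  then have "C * (y - x) \<le> m x * (y - x)" using \<open>x \<le> y\<close> by (intro mult_right_mono) auto
  then show "g x - C * x \<le> g y - C * y" using sub[of x y] by (simp add: algebra_simps)
qed

text \<open>Since \<open>t\<close> is negative, the tangent at a single point with slope below \<open>C + \<eta>\<close> provides this bound.\<close>

lemma convex_lower_asymptote: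
  fixes g :: "real \<Rightarrow> real"
  assumes conv: "convex_on UNIV g" and lim: "deriv_tendsto_at_bot g C" and \<eta>: "\<eta> > 0"
  shows "\<forall>\<^sub>F t in at_bot. (C + \<eta>) * t \<le> g t"
proof -
  obtain m where sub: "\<And>x y. g x + m x * (y - x) \<le> g y" using convex_subgradient_exists[OF conv] by blast
  have "eventually (\<lambda>t. deriv g t < C + \<eta> / 2) (inf at_bot (principal {t. g differentiable (at t)}))"
    using lim \<eta> unfolding deriv_tendsto_at_bot_def by (auto intro: order_tendstoD)
  then obtain z where "deriv g z < C + \<eta> / 2" "(g has_real_derivative m z) (at z)"
    by (rule differentiable_points_unbounded_below[OF sub])
  then have mz: "m z < C + \<eta> / 2" using DERIV_imp_deriv[of g "m z" z] by simp
  define k where "k = g z - m z * z"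
  have "\<forall>\<^sub>F t::real in at_bot. t \<le> min 0 (2 * k / \<eta>)" by (rule eventually_le_at_bot)
  then show ?thesis
  proof eventually_elim
    case (elim t)
    have "t \<le> 0" and "\<eta> * t \<le> 2 * k" using elim \<eta> by (simp_all add: field_simps)
    have "(C + \<eta>) * t = (C + \<eta> / 2) * t + \<eta> * t / 2" by (simp add: field_simps)
    also have "\<dots> \<le> m z * t + k"
      using mult_right_mono_neg[OF less_imp_le[OF mz] \<open>t \<le> 0\<close>] \<open>\<eta> * t \<le> 2 * k\<close> by simp
    also have "\<dots> \<le> g t" using sub[of z t] by (simp add: k_def algebra_simps)
    finally show ?case .
  qed
qed

lemma mono_at_bot_cases:
  fixes h :: "real \<Rightarrow> real"
  assumes "mono h"
  shows "(\<exists>l. (h \<longlongrightarrow> l) at_bot) \<or> filterlim h at_bot at_bot"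
proof (cases "bdd_below (range h)")
  case True
  have "(h \<longlongrightarrow> Inf (range h)) at_bot"
  proof (rule order_tendstoI)
    fix a assume "a < Inf (range h)"
    then have "\<And>x. a < h x" by (meson True cINF_lower UNIV_I less_le_trans)
    then show "\<forall>\<^sub>F x in at_bot. a < h x" by simp
  next
    fix a assume "a > Inf (range h)"
    then obtain x where "h x < a" by (meson cINF_less_iff True UNIV_not_empty)
    then show "\<forall>\<^sub>F x in at_bot. h x < a"
      using assms unfolding eventually_at_bot_linorder by (meson monoD le_less_trans)
  qed
  then show ?thesis by blast
next
  case False
  have "filterlim h at_bot at_bot"
    unfolding filterlim_at_bot
  proof
    fix Z
    obtain x where "h x < Z" using False unfolding bdd_below_def by (auto simp: not_le)
    then show "\<forall>\<^sub>F x in at_bot. h x \<le> Z"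
      using assms unfolding eventually_at_bot_linorder by (meson monoD le_less_trans less_imp_le)
  qed
  then show ?thesis by blast
qed

section \<open>Lebesgue measure under conformal linear maps\<close>

lemma nn_integral_lborel_translate:
  fixes f :: "'a::euclidean_space \<Rightarrow> ennreal"
  assumes [measurable]: "f \<in> borel_measurable borel"
  shows "(\<integral>\<^sup>+x. f (c + x) \<partial>lborel) = (\<integral>\<^sup>+x. f x \<partial>lborel)"
  by (subst (2) lborel_distr_plus[of c, symmetric]) (simp add: nn_integral_distr)

text \<open>The image of Lebesgue measure under \<open>T\<close> is again translation invariant, and such measures are unique
  up to a factor. The uniqueness is proved here by the usual Fubini computation, testing against the
  unit ball; the factor is read off because \<open>T\<close> maps balls to balls.\<close>

lemma nn_integral_lborel_conformal_linear:
  fixes T :: "'a::euclidean_space \<Rightarrow> 'a"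
  assumes lin: "linear T" and s: "s > 0" and nT: "\<And>x. norm (T x) = s * norm x"
    and f: "f \<in> borel_measurable borel"
  shows "(\<integral>\<^sup>+x. f (T x) \<partial>lborel) = ennreal ((1 / s) ^ DIM('a)) * (\<integral>\<^sup>+x. f x \<partial>lborel)"
proof -
  define B where "B = (ball 0 1 :: 'a set)"
  define k where "k = ennreal ((1 / s) ^ DIM('a))"
  have [measurable]: "T \<in> borel_measurable borel"
    using lin by (intro borel_measurable_continuous_onI linear_continuous_on linear_conv_bounded_linear[THEN iffD1])
  have [measurable]: "B \<in> sets borel" by (simp add: B_def)
  have "inj T"
    unfolding linear_injective_0[OF lin] using nT s by (metis mult_eq_0_iff norm_eq_zero less_irrefl)
  then have surjT: "surj T" using lin linear_injective_imp_surjective by blast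
  have emB: "emeasure lborel (ball c r :: 'a set) = ennreal (r ^ DIM('a)) * emeasure lborel B"
    if "r > 0" for c r
    using that by (simp add: B_def emeasure_ball ennreal_mult' mult.commute unit_ball_vol_nonneg)
  have B0: "emeasure lborel B \<noteq> 0" "emeasure lborel B \<noteq> \<infinity>"
    unfolding B_def by (auto simp add: emeasure_ball unit_ball_vol_pos less_imp_neq[symmetric])
  have inner: "(\<integral>\<^sup>+x. indicator B (y - T x) \<partial>lborel) = k * emeasure lborel B" for y
  proof -
    obtain y' where y': "y = T y'" using surjT by auto
    have "indicator B (y - T x) = (indicator (ball y' (1 / s)) x :: ennreal)" for x
    proof -
      have "norm (y - T x) = s * norm (y' - x)"
        by (simp add: y' nT[symmetric] linear_diff[OF lin])
      then show ?thesis
        using s by (simp add: B_def dist_norm indicator_def field_simps norm_minus_commute[of "T x" y])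
    qed
    then show ?thesis using emB[of "1 / s" y'] s by (simp add: k_def)
  qed
  have shift: "(\<integral>\<^sup>+x. indicator A (T x) \<partial>lborel) = (\<integral>\<^sup>+x. indicator A (T x + y) \<partial>lborel)"
    if [measurable]: "A \<in> sets borel" for A y
  proof -
    obtain y' where y': "y = T y'" using surjT by auto
    have "(\<integral>\<^sup>+x. indicator A (T x + y) \<partial>lborel) = (\<integral>\<^sup>+x. indicator A (T (y' + x)) \<partial>lborel)"
      by (simp add: y' linear_add[OF lin] add.commute)
    also have "\<dots> = (\<integral>\<^sup>+x. indicator A (T x) \<partial>lborel)"
      by (rule nn_integral_lborel_translate) measurable
    finally show ?thesis by simp
  qed
  \<comment> \<open>Both sides times the volume of \<open>B\<close> are the integral of \<open>A(T x + y) B(y)\<close> over pairs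
    \<open>(x, y)\<close>: one evaluates it by translating \<open>x\<close>, the other by translating \<open>y\<close>.\<close>
  have main: "(\<integral>\<^sup>+x. indicator A (T x) \<partial>lborel) = k * emeasure lborel A"
    if A[measurable]: "A \<in> sets borel" for A
  proof -
    have "(\<integral>\<^sup>+x. indicator A (T x) \<partial>lborel) * emeasure lborel B
        = (\<integral>\<^sup>+y. (\<integral>\<^sup>+x. indicator A (T x) \<partial>lborel) * indicator B y \<partial>lborel)"
      by (simp add: nn_integral_cmult)
    also have "\<dots> = (\<integral>\<^sup>+y. (\<integral>\<^sup>+x. indicator A (T x + y) * indicator B y \<partial>lborel) \<partial>lborel)"
      proof (rule nn_integral_cong)
      fix y
      show "(\<integral>\<^sup>+x. indicator A (T x) \<partial>lborel) * indicator B y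
          = (\<integral>\<^sup>+x. indicator A (T x + y) * indicator B y \<partial>lborel)"
        by (simp add: nn_integral_multc shift[OF A, of y])
    qed
    also have "\<dots> = (\<integral>\<^sup>+x. (\<integral>\<^sup>+y. indicator A (T x + y) * indicator B y \<partial>lborel) \<partial>lborel)"
      by (rule lborel_pair.Fubini') measurable
    also have "\<dots> = (\<integral>\<^sup>+x. (\<integral>\<^sup>+y. indicator A y * indicator B (y - T x) \<partial>lborel) \<partial>lborel)"
    proof (rule nn_integral_cong)
      fix x
      show "(\<integral>\<^sup>+y. indicator A (T x + y) * indicator B y \<partial>lborel)
          = (\<integral>\<^sup>+y. indicator A y * indicator B (y - T x) \<partial>lborel)"
        using nn_integral_lborel_translate[of "\<lambda>y. indicator A y * indicator B (y - T x)" "T x"] by simp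
    qed
    also have "\<dots> = (\<integral>\<^sup>+y. (\<integral>\<^sup>+x. indicator A y * indicator B (y - T x) \<partial>lborel) \<partial>lborel)"
      by (rule lborel_pair.Fubini') measurable
    also have "\<dots> = (\<integral>\<^sup>+y. indicator A y * (k * emeasure lborel B) \<partial>lborel)"
      by (subst nn_integral_cmult) (simp_all add: inner)
    also have "\<dots> = k * emeasure lborel A * emeasure lborel B"
      by (subst nn_integral_multc) (simp_all add: ac_simps)
    finally show ?thesis
      using B0 ennreal_mult_cancel_left[of "emeasure lborel B"] by (simp add: mult.commute)
  qed
  have "distr lborel borel T = scale_measure k lborel"
  proof (rule measure_eqI)
    fix A assume "A \<in> sets (distr lborel borel T)"
    then have A[measurable]: "A \<in> sets borel" by simp
    have "emeasure (distr lborel borel T) A = (\<integral>\<^sup>+x. indicator A x \<partial>distr lborel borel T)" by simp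
    also have "\<dots> = (\<integral>\<^sup>+x. indicator A (T x) \<partial>lborel)" by (rule nn_integral_distr) auto
    finally show "emeasure (distr lborel borel T) A = emeasure (scale_measure k lborel) A"
      using main[OF A] by simp
  qed simp
  then have "(\<integral>\<^sup>+x. f x \<partial>distr lborel borel T) = (\<integral>\<^sup>+x. f x \<partial>scale_measure k lborel)" by simp
  then show ?thesis
    using f by (simp add: nn_integral_distr nn_integral_scale_measure k_def)
qed

lemma norm_vector_scalar_mult_complex: "norm (w *s b) = cmod w * norm (b :: complex ^ 'n)"
  by (simp add: norm_vec_def norm_mult L2_set_right_distrib)

lemma linear_vector_scalar_mult_complex: "linear (\<lambda>b :: complex ^ 'n. w *s b)"
  by (rule linearI) (simp_all add: vec_eq_iff algebra_simps)

lemma continuous_on_vector_scalar_mult [continuous_intros]: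
  "continuous_on S f \<Longrightarrow> continuous_on S g \<Longrightarrow> continuous_on S (\<lambda>x. f x *s (g x :: complex ^ 'n))"
  unfolding vector_scalar_mult_def by (intro continuous_intros)

lemma nn_integral_complex_dilation:
  fixes f :: "complex ^ 'n \<Rightarrow> ennreal"
  assumes "w \<noteq> 0" "f \<in> borel_measurable borel"
  shows "(\<integral>\<^sup>+b. f (w *s b) \<partial>lborel)
       = ennreal ((1 / cmod w) ^ (2 * CARD('n))) * (\<integral>\<^sup>+z. f z \<partial>lborel)"
  using nn_integral_lborel_conformal_linear[OF linear_vector_scalar_mult_complex[of w], of "cmod w" f] assms
  by (simp add: norm_vector_scalar_mult_complex mult.commute)

lemma nn_integral_complex_rotation:
  fixes f :: "complex \<Rightarrow> ennreal"
  assumes "cmod w = 1" "f \<in> borel_measurable borel"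
  shows "(\<integral>\<^sup>+z. f (w * z) \<partial>lborel) = (\<integral>\<^sup>+z. f z \<partial>lborel)"
proof -
  have "linear (\<lambda>z. w * z)" by (rule linearI) (simp_all add: algebra_simps)
  from nn_integral_lborel_conformal_linear[OF this, of 1 f] assms show ?thesis by (simp add: norm_mult)
qed

section \<open>Upper semicontinuous functions\<close>

lemma usc_on_subset: "usc_on U u \<Longrightarrow> K \<subseteq> U \<Longrightarrow> usc_on K u"
  unfolding usc_on_def
proof (intro allI)
  fix c assume "\<forall>c. openin (top_of_set U) {z \<in> U. u z < c}" and "K \<subseteq> U"
  then obtain T where "open T" "{z \<in> U. u z < c} = U \<inter> T" by (metis openin_open)
  then have "{z \<in> K. u z < c} = K \<inter> T" using \<open>K \<subseteq> U\<close> by blast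
  then show "openin (top_of_set K) {z \<in> K. u z < c}" using \<open>open T\<close> by (metis openin_open)
qed

lemma usc_on_add_continuous:
  fixes q :: "'a::topological_space \<Rightarrow> real"
  assumes u: "usc_on K u" and q: "continuous_on K q"
  shows "usc_on K (\<lambda>z. u z + ereal (q z))"
  unfolding usc_on_def
proof
  fix c :: ereal
  have "openin (top_of_set K) {z \<in> K. u z + ereal (q z) < c}"
  proof (cases c)
    case (real c')
    have eq: "{z \<in> K. u z + ereal (q z) < c}
      = (\<Union>d. {z \<in> K. u z < ereal d} \<inter> (K \<inter> q -` {..<c' - d}))" (is "?A = ?B")
    proof (intro set_eqI iffI)
      fix z assume "z \<in> ?A"
      then have z: "z \<in> K" "u z < ereal (c' - q z)" unfolding real by (cases "u z"; auto)+
      then obtain d where "u z < ereal d" "ereal d < ereal (c' - q z)"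
        using ereal_dense2 by blast
      then show "z \<in> ?B" using z by auto
    next
      fix z assume "z \<in> ?B"
      then show "z \<in> ?A" unfolding real by (cases "u z") auto
    qed
    show ?thesis
      unfolding eq using u continuous_openin_preimage_gen[OF q open_lessThan]
      by (intro openin_Union openin_Int) (auto simp: usc_on_def)
  next
    case PInf
    then have "{z \<in> K. u z + ereal (q z) < c} = {z \<in> K. u z < c}" by auto
    then show ?thesis using u by (simp add: usc_on_def)
  qed auto
  then show "openin (top_of_set K) {z \<in> K. u z + ereal (q z) < c}" .
qed

lemma usc_on_attains_max:
  assumes "compact K" "K \<noteq> {}" "usc_on K f"
  obtains p where "p \<in> K" "\<And>z. z \<in> K \<Longrightarrow> f z \<le> f p"
proof (rule ccontr)
  assume nt: "\<not> thesis"
  have nomax: "\<forall>p\<in>K. \<exists>q\<in>K. f p < f q"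
  proof (rule ccontr)
    assume "\<not> ?thesis"
    then obtain p where "p \<in> K" "\<And>z. z \<in> K \<Longrightarrow> f z \<le> f p" by (auto simp: not_less)
    from that[OF this] nt show False by simp
  qed
  have "\<forall>q. \<exists>T. open T \<and> {z \<in> K. f z < f q} = K \<inter> T"
    using assms(3) unfolding usc_on_def openin_open by auto
  from choice[OF this]
  obtain T where T: "\<And>q. open (T q)" "\<And>q. {z \<in> K. f z < f q} = K \<inter> T q" by blast
  have "K \<subseteq> (\<Union>q\<in>K. T q)" using nomax T(2) by blast
  then obtain F where F: "F \<subseteq> K" "finite F" "K \<subseteq> (\<Union>q\<in>F. T q)"
    using compactE_image[OF assms(1), of K T] T(1) by metis
  then have "F \<noteq> {}" using assms(2) by auto
  then have "Max (f ` F) \<in> f ` F" using F(2) by simp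
  then obtain q where q: "q \<in> F" "f q = Max (f ` F)" by auto
  then obtain q' where "q' \<in> F" "q \<in> T q'" using F by blast
  then have "f q < f q'" using T(2)[of q'] q(1) F(1) by blast
  moreover have "f q' \<le> f q" using \<open>q' \<in> F\<close> F(2) q(2) by simp
  ultimately show False by simp
qed

lemma usc_on_borel_measurable:
  assumes "open U" "usc_on U u"
  shows "(\<lambda>z. if z \<in> U then u z else -\<infinity>) \<in> borel_measurable borel"
proof (rule borel_measurableI_less)
  fix c
  have "open {z \<in> U. u z < c}" using assms unfolding usc_on_def openin_open
    by (metis open_Int)
  moreover have "{z \<in> space borel. (if z \<in> U then u z else -\<infinity>) < c}
     = (if c = -\<infinity> then {} else {z \<in> U. u z < c} \<union> - U)" by auto
  ultimately show "{z \<in> space borel. (if z \<in> U then u z else -\<infinity>) < c} \<in> sets borel"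
    using assms(1) by simp
qed

section \<open>Mean values of subharmonic functions\<close>

lemma circle_mean_le_integral:
  assumes cont: "continuous_on {0..2*pi} (\<lambda>t. f (c + of_real r * cis t))"
    and le: "\<And>t. t \<in> {0..2*pi} \<Longrightarrow> u (c + of_real r * cis t) \<le> ereal (f (c + of_real r * cis t))"
  shows "circle_mean u c r \<le> ereal (integral {0..2*pi} (\<lambda>t. f (c + of_real r * cis t)) / (2 * pi))"
proof -
  define F where "F t = f (c + of_real r * cis t)" for t
  define A where "A = (\<integral>\<^sup>+ t \<in> {0..2*pi}. ennreal (F t) \<partial>lborel)"
  define B where "B = (\<integral>\<^sup>+ t \<in> {0..2*pi}. ennreal (- F t) \<partial>lborel)"
  have int: "set_integrable lborel {0..2*pi} F"
    using cont unfolding F_def by (rule borel_integrable_atLeastAtMost')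
  have A': "A = (\<integral>\<^sup>+ t. ennreal (indicator {0..2*pi} t *\<^sub>R F t) \<partial>lborel)"
    and B': "B = (\<integral>\<^sup>+ t. ennreal (- (indicator {0..2*pi} t *\<^sub>R F t)) \<partial>lborel)"
    unfolding A_def B_def by (auto intro!: nn_integral_cong simp: indicator_def)
  have fin: "A \<noteq> \<infinity>" "B \<noteq> \<infinity>"
    using int unfolding A' B' set_integrable_def real_integrable_def by auto
  have "integral {0..2*pi} F = (LINT t:{0..2*pi}|lborel. F t)"
    using set_borel_integral_eq_integral(2)[OF int] by simp
  also have "\<dots> = enn2real A - enn2real B"
    using int unfolding A' B' set_integrable_def set_lebesgue_integral_def
    by (rule real_lebesgue_integral_def)
  finally have eq: "integral {0..2*pi} F = enn2real A - enn2real B" .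
  have P: "(\<integral>\<^sup>+ t \<in> {0..2*pi}. e2ennreal (u (c + of_real r * cis t)) \<partial>lborel) \<le> A"
    unfolding A_def F_def
    by (rule nn_integral_mono)
       (use le e2ennreal_mono in \<open>fastforce simp: indicator_def e2ennreal_ereal[symmetric] simp del: e2ennreal_ereal\<close>)
  have Q: "B \<le> (\<integral>\<^sup>+ t \<in> {0..2*pi}. e2ennreal (- u (c + of_real r * cis t)) \<partial>lborel)"
    unfolding B_def F_def
  proof (rule nn_integral_mono)
    fix t
    show "ennreal (- f (c + of_real r * cis t)) * indicator {0..2*pi} t
       \<le> e2ennreal (- u (c + of_real r * cis t)) * indicator {0..2*pi} t"
    proof (cases "t \<in> {0..2*pi}")
      case True
      then have "ereal (- f (c + of_real r * cis t)) \<le> - u (c + of_real r * cis t)"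
        using le[OF True] by (metis ereal_minus_le_minus uminus_ereal.simps(1))
      from e2ennreal_mono[OF this] True show ?thesis by simp
    qed simp
  qed
  have "enn2ereal (\<integral>\<^sup>+ t \<in> {0..2*pi}. e2ennreal (u (c + of_real r * cis t)) \<partial>lborel)
      - enn2ereal (\<integral>\<^sup>+ t \<in> {0..2*pi}. e2ennreal (- u (c + of_real r * cis t)) \<partial>lborel)
      \<le> enn2ereal A - enn2ereal B"
    using P Q by (intro ereal_minus_mono) (simp_all add: less_eq_ennreal.rep_eq)
  also have "\<dots> = ereal (integral {0..2*pi} F)"
    using fin unfolding eq by (cases A; cases B) (auto simp: enn2ereal_ennreal)
  finally have "circle_mean u c r \<le> ereal (integral {0..2*pi} F) / ereal (2 * pi)"
    unfolding circle_mean_def by (intro ereal_divide_right_mono) auto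
  then show ?thesis by (simp add: F_def[abs_def])
qed

lemma holomorphic_circle_mean_Re:
  assumes hol: "H holomorphic_on cball p r" and r: "r > 0"
  shows "continuous_on {0..2*pi} (\<lambda>t. Re (H (p + of_real r * cis t)))"
    and "integral {0..2*pi} (\<lambda>t. Re (H (p + of_real r * cis t))) = 2 * pi * Re (H p)"
proof -
  show "continuous_on {0..2*pi} (\<lambda>t. Re (H (p + of_real r * cis t)))"
    using r by (intro continuous_intros continuous_on_compose2[OF holomorphic_on_imp_continuous_on[OF hol]])
       (auto simp: dist_norm norm_mult)
  have "((\<lambda>u. H u / (u - p)) has_contour_integral (2 * of_real pi * \<i> * H p)) (circlepath p r)"
    by (rule Cauchy_integral_circlepath_simple[OF hol]) (use r in simp)
  then have "((\<lambda>t. H (p + of_real r * cis t) / (of_real r * cis t) * of_real r * \<i> * cis t)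
       has_integral (2 * of_real pi * \<i> * H p)) {0..2*pi}"
    unfolding circlepath_def by (subst (asm) has_contour_integral_part_circlepath_iff) (simp_all add: mult.assoc)
  then have "((\<lambda>t. \<i> * H (p + of_real r * cis t)) has_integral (2 * of_real pi * \<i> * H p)) {0..2*pi}"
    by (rule has_integral_eq[rotated]) (use r in simp)
  from has_integral_linear[OF this bounded_linear_Im]
  have "((\<lambda>t. Re (H (p + of_real r * cis t))) has_integral 2 * pi * Re (H p)) {0..2*pi}"
    by (simp add: o_def)
  then show "integral {0..2*pi} (\<lambda>t. Re (H (p + of_real r * cis t))) = 2 * pi * Re (H p)"
    by (rule integral_unique)
qed

text \<open>Off the origin, \<open>q\<close> is a harmonic function plus \<open>\<eta> \<bar>z\<bar>\<^sup>2\<close>, so its mean over a circle about \<open>p\<close> exceeds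
  \<open>q p\<close> by exactly \<open>\<eta> r\<^sup>2\<close>. Thus the submean inequality for \<open>u + q\<close> has a positive margin, and an
  interior maximum of \<open>u + q\<close> contradicts it without any discussion of where equality holds.\<close>

lemma subharmonic_log_perturbation_strict:
  fixes \<beta> \<eta> m :: real
  defines "q \<equiv> \<lambda>z. - \<beta> * ln (cmod z) + \<eta> * (cmod z)\<^sup>2"
  assumes sh: "subharmonic_on S u" and r: "0 < r" "cball p r \<subseteq> S" and p: "r < cmod p"
    and le: "\<And>z. cmod (z - p) = r \<Longrightarrow> u z + ereal (q z) \<le> ereal m"
  shows "u p + ereal (q p + \<eta> * r\<^sup>2) \<le> ereal m"
proof -
  \<comment> \<open>On the circle, \<open>q\<close> is the constant \<open>\<eta> r\<^sup>2\<close> plus the real part of this holomorphic function: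
    \<open>\<bar>z\<bar>\<^sup>2\<close> is expanded about \<open>p\<close>, and the logarithm is taken of \<open>z / p\<close>, which stays in the right
    half-plane.\<close>
  define H where "H z = - of_real \<beta> * (Ln (z / p) + of_real (ln (cmod p)))
     + of_real \<eta> * (of_real ((cmod p)\<^sup>2) + 2 * cnj p * (z - p))" for z
  have p0: "p \<noteq> 0" using p r by auto
  have pos: "Re (z / p) > 0" if "z \<in> cball p r" for z
  proof -
    have "cmod (z / p - 1) = cmod (z - p) / cmod p" using p0 by (simp add: norm_divide[symmetric] diff_divide_distrib)
    also have "\<dots> < 1" using that p r by (simp add: dist_norm norm_minus_commute divide_less_eq)
    finally show ?thesis using abs_Re_le_cmod[of "z / p - 1"] by simp
  qed
  have hol: "H holomorphic_on cball p r"
    unfolding H_def using pos p0 by (auto intro!: holomorphic_intros simp: complex_nonpos_Reals_iff) (metis not_less)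
  have ReH: "Re (H z) + \<eta> * (cmod (z - p))\<^sup>2 = q z" if "z \<in> cball p r" for z
  proof -
    have "z \<noteq> 0" using pos[OF that] by auto
    then have L: "Re (Ln (z / p)) = ln (cmod z) - ln (cmod p)"
      using p0 by (simp add: norm_divide ln_div)
    define X where "X = Re (cnj p * (z - p))"
    have Z: "(cmod z)\<^sup>2 = (cmod p)\<^sup>2 + 2 * X + (cmod (z - p))\<^sup>2"
      unfolding cmod_power2 X_def by (simp add: power2_eq_square algebra_simps)
    have "Re (H z) = - \<beta> * (Re (Ln (z / p)) + ln (cmod p)) + \<eta> * ((cmod p)\<^sup>2 + 2 * X)"
      by (simp add: H_def X_def algebra_simps)
    then show ?thesis by (simp add: q_def L Z algebra_simps)
  qed
  define f where "f z = m - \<eta> * r\<^sup>2 - Re (H z)" for z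
  have cont: "continuous_on {0..2*pi} (\<lambda>t. f (p + of_real r * cis t))"
    unfolding f_def by (intro continuous_intros holomorphic_circle_mean_Re(1)[OF hol r(1)])
  have "u p \<le> circle_mean u p r" using sh r by (simp add: subharmonic_on_def)
  also have "\<dots> \<le> ereal (integral {0..2*pi} (\<lambda>t. f (p + of_real r * cis t)) / (2 * pi))"
  proof (rule circle_mean_le_integral[OF cont])
    fix t
    let ?z = "p + of_real r * cis t"
    have z: "cmod (?z - p) = r" using r by (simp add: norm_mult)
    then have "?z \<in> cball p r" by (simp add: dist_norm norm_minus_commute)
    from ReH[OF this] z have "f ?z = m - q ?z" by (simp add: f_def)
    then show "u ?z \<le> ereal (f ?z)" using le[OF z] by (cases "u ?z") auto
  qed
  also have "integral {0..2*pi} (\<lambda>t. f (p + of_real r * cis t))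
     = (m - \<eta> * r\<^sup>2) * (2 * pi) - 2 * pi * Re (H p)"
    unfolding f_def using holomorphic_circle_mean_Re[OF hol r(1)]
    by (subst integral_diff) (auto intro!: integrable_continuous_interval)
  also have "\<dots> / (2 * pi) = m - \<eta> * r\<^sup>2 - Re (H p)" by (simp add: field_simps)
  finally show ?thesis using ReH[of p] r by (cases "u p") auto
qed

text \<open>An extended maximum principle. The function \<open>u - (\<alpha> - \<epsilon>) ln \<bar>w\<bar>\<close> tends to \<open>-\<infinity>\<close> at the origin, so it
  is bounded by its maximum on the circle of radius \<open>R\<close>; this bound stays finite as \<open>\<epsilon> \<rightarrow> 0\<close>.\<close>

lemma removable_log_bound:
  fixes \<alpha> R :: real
  assumes sh: "subharmonic_on S u" and R: "R > 0" "cball 0 R \<subseteq> S"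
    and ev: "\<And>\<epsilon>. \<epsilon> > 0 \<Longrightarrow> \<forall>\<^sub>F w in at 0. u w \<le> ereal ((\<alpha> - \<epsilon>) * ln (cmod w))"
  shows "\<exists>C. \<forall>w. w \<noteq> 0 \<and> cmod w \<le> R \<longrightarrow> u w \<le> ereal (\<alpha> * ln (cmod w) + C)"
proof -
  have usc: "usc_on S u" and fin: "\<And>z. z \<in> S \<Longrightarrow> u z \<noteq> \<infinity>"
    using sh by (auto simp: subharmonic_on_def)
  have "sphere (0::complex) R \<subseteq> S" using R by auto
  then obtain p0 where p0: "p0 \<in> sphere 0 R" "\<And>z. z \<in> sphere 0 R \<Longrightarrow> u z \<le> u p0"
    using usc_on_attains_max[of "sphere (0::complex) R" u] usc_on_subset[OF usc, of "sphere 0 R"] R(1) by auto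
  obtain M where "u p0 \<le> ereal M"
    using fin[of p0] p0(1) \<open>sphere 0 R \<subseteq> S\<close> by (cases "u p0") auto
  then have M: "u z \<le> ereal M" if "cmod z = R" for z
    using p0(2)[of z] that by (auto intro: order_trans)
  define C where "C = M - \<alpha> * ln R"
  have claim: "x - (\<alpha> - \<epsilon>) * ln (cmod w) \<le> C + \<epsilon> * ln R"
    if \<epsilon>: "\<epsilon> > 0" and w: "w \<noteq> 0" "cmod w \<le> R" and x: "u w = ereal x" for \<epsilon> w x
  proof (rule ccontr)
    assume neg: "\<not> ?thesis"
    \<comment> \<open>The term \<open>\<eta> \<bar>z\<bar>\<^sup>2\<close> makes the submean inequality strict; \<open>\<eta>\<close> is so small that the
      value at \<open>w\<close> still exceeds the values on the circle of radius \<open>R\<close>.\<close>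
    define gap where "gap = x - (\<alpha> - \<epsilon>) * ln (cmod w) - (C + \<epsilon> * ln R)"
    have gap: "gap > 0" using neg by (simp add: gap_def)
    define \<eta> where "\<eta> = gap / (2 * R\<^sup>2)"
    have \<eta>: "\<eta> > 0" "\<eta> * R\<^sup>2 < gap" using gap R by (simp_all add: \<eta>_def)
    define q where "q z = - (\<alpha> - \<epsilon>) * ln (cmod z) + \<eta> * (cmod z)\<^sup>2" for z
    define y where "y = x + q w"
    have "\<eta> * (cmod w)\<^sup>2 \<ge> 0" using \<eta> by simp
    moreover have "y = gap + (C + \<epsilon> * ln R) + \<eta> * (cmod w)\<^sup>2"
      by (simp add: y_def q_def gap_def algebra_simps)
    ultimately have y: "y > C + \<epsilon> * ln R + \<eta> * R\<^sup>2" using \<eta> by linarith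
    have outer: "u z + ereal (q z) < ereal y" if "cmod z = R" for z
    proof -
      have "u z + ereal (q z) \<le> ereal M + ereal (q z)" by (intro add_mono M that) simp
      also have "\<dots> = ereal (C + \<epsilon> * ln R + \<eta> * R\<^sup>2)" by (simp add: q_def C_def that algebra_simps)
      also have "\<dots> < ereal y" using y by simp
      finally show ?thesis .
    qed
    have "\<forall>\<^sub>F z in at 0. u z + ereal (q z) < ereal y"
    proof -
      define d where "d = min 1 (exp ((2 / \<epsilon>) * (y - \<eta>)))"
      have "d > 0" by (simp add: d_def)
      then have "\<forall>\<^sub>F z :: complex in at 0. cmod z < d \<and> z \<noteq> 0"
        by (auto simp: eventually_at dist_norm intro: exI[of _ d])
      then show ?thesis using ev[OF half_gt_zero[OF \<epsilon>]]
      proof (eventually_elim)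
        case (elim z)
        have "cmod z > 0" "cmod z < 1" "cmod z < exp ((2 / \<epsilon>) * (y - \<eta>))" using elim by (auto simp: d_def)
        then have "ln (cmod z) < (2 / \<epsilon>) * (y - \<eta>)" by (metis ln_less_cancel_iff ln_exp exp_gt_zero)
        then have 1: "\<epsilon> / 2 * ln (cmod z) < y - \<eta>" using \<epsilon> by (simp add: field_simps)
        have "(cmod z)\<^sup>2 \<le> 1" using \<open>cmod z < 1\<close> by (simp add: power_le_one)
        then have 2: "\<eta> * (cmod z)\<^sup>2 \<le> \<eta>" using \<eta> by (simp add: mult_left_le)
        have "u z + ereal (q z) \<le> ereal ((\<alpha> - \<epsilon> / 2) * ln (cmod z)) + ereal (q z)"
          using elim \<epsilon> by (intro add_mono) auto
        also have "\<dots> = ereal (\<epsilon> / 2 * ln (cmod z) + \<eta> * (cmod z)\<^sup>2)"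
          by (simp add: q_def field_simps)
        also have "\<dots> < ereal y" using 1 2 by simp
        finally show ?case .
      qed
    qed
    then obtain e where e: "e > 0" "\<And>z. z \<noteq> 0 \<Longrightarrow> cmod z < e \<Longrightarrow> u z + ereal (q z) < ereal y"
      unfolding eventually_at by (auto simp: dist_norm)
    define \<delta> where "\<delta> = e / 2"
    have \<delta>: "\<delta> > 0" "\<And>z. z \<noteq> 0 \<Longrightarrow> cmod z \<le> \<delta> \<Longrightarrow> u z + ereal (q z) < ereal y"
      using e by (auto simp: \<delta>_def)
    define K where "K = cball 0 R - ball (0::complex) \<delta>"
    have K: "z \<in> K \<longleftrightarrow> \<delta> \<le> cmod z \<and> cmod z \<le> R" for z by (auto simp: K_def)
    have "cmod w > \<delta>" using \<delta>(2)[of w] w by (force simp: x y_def)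
    then have "w \<in> K" using w by (simp add: K)
    have "compact K" unfolding K_def by (intro compact_diff) auto
    have "K \<subseteq> S" using R by (auto simp: K_def)
    have "continuous_on K q" unfolding q_def using \<delta>(1)
      by (intro continuous_intros) (auto simp: K)
    then have "usc_on K (\<lambda>z. u z + ereal (q z))"
      by (intro usc_on_add_continuous usc_on_subset[OF usc \<open>K \<subseteq> S\<close>])
    then obtain p where p: "p \<in> K" "\<And>z. z \<in> K \<Longrightarrow> u z + ereal (q z) \<le> u p + ereal (q p)"
      using usc_on_attains_max[of K "\<lambda>z. u z + ereal (q z)"] \<open>compact K\<close> \<open>w \<in> K\<close> by blast
    have py: "ereal y \<le> u p + ereal (q p)" using p(2)[OF \<open>w \<in> K\<close>] by (simp add: x y_def)
    obtain a where a: "u p = ereal a"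
      using py fin[of p] p(1) \<open>K \<subseteq> S\<close> by (cases "u p") auto
    have "cmod p \<noteq> R" using outer[of p] py by (auto simp: not_less[symmetric])
    moreover have "p \<noteq> 0" using p(1) K[of p] \<delta>(1) by auto
    then have "\<not> cmod p \<le> \<delta>" using \<delta>(2)[of p] py by (meson not_less)
    ultimately have cp: "\<delta> < cmod p" "cmod p < R" using p(1) K[of p] by auto
    define r where "r = min (cmod p - \<delta>) (R - cmod p)"
    have r: "r > 0" "r < cmod p" "r \<le> cmod p - \<delta>" "r \<le> R - cmod p" using cp \<delta> by (auto simp: r_def)
    have inK: "z \<in> K" if "cmod (z - p) \<le> r" for z
      using that norm_triangle_ineq2[of p z] norm_triangle_ineq2[of z p] r(3,4) K[of z]
      by (simp add: norm_minus_commute)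
    have "u p + ereal (q p + \<eta> * r\<^sup>2) \<le> ereal (a + q p)"
      unfolding q_def
    proof (rule subharmonic_log_perturbation_strict[OF sh r(1) _ r(2)])
      show "cball p r \<subseteq> S" using inK \<open>K \<subseteq> S\<close> by (auto simp: dist_norm norm_minus_commute)
      fix z assume "cmod (z - p) = r"
      then show "u z + ereal (- (\<alpha> - \<epsilon>) * ln (cmod z) + \<eta> * (cmod z)\<^sup>2)
         \<le> ereal (a + (- (\<alpha> - \<epsilon>) * ln (cmod p) + \<eta> * (cmod p)\<^sup>2))"
        using p(2)[OF inK, of z] by (simp add: a q_def)
    qed
    moreover have "\<eta> * r\<^sup>2 > 0" using \<eta>(1) r(1) by simp
    ultimately show False using a by simp
  qed
  have "u w \<le> ereal (\<alpha> * ln (cmod w) + C)" if w: "w \<noteq> 0" "cmod w \<le> R" for w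
  proof (cases "u w")
    case (real x)
    have "x \<le> \<alpha> * ln (cmod w) + C"
    proof (rule ccontr)
      assume contra: "\<not> ?thesis"
      \<comment> \<open>Letting \<open>\<epsilon> \<rightarrow> 0\<close> in \<open>claim\<close> amounts to this: \<open>e = d / (D + 1)\<close> satisfies \<open>e D < d\<close>, whereas
        \<open>claim\<close> says \<open>d \<le> e D\<close>.\<close>
      define D d where "D = ln R - ln (cmod w)" and "d = x - \<alpha> * ln (cmod w) - C"
      have D: "D \<ge> 0" and d: "d > 0" using w contra R by (auto simp: D_def d_def)
      define e where "e = d / (D + 1)"
      have "e > 0" using d D by (simp add: e_def)
      from claim[OF this w real] have "d \<le> e * D" by (simp add: D_def d_def algebra_simps)
      then have "d * (D + 1) \<le> d * D" using D by (simp add: e_def field_simps)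
      then show False using d by (simp add: algebra_simps)
    qed
    then show ?thesis using real by simp
  next
    case PInf
    then show ?thesis using fin[of w] w R by auto
  qed auto
  then show ?thesis by blast
qed

lemma nn_integral_periodic_shift:
  fixes k :: "real \<Rightarrow> ennreal"
  assumes [measurable]: "k \<in> borel_measurable borel" and per: "\<And>t. k (t + 2 * pi) = k t"
    and s: "0 \<le> s" "s \<le> 2 * pi"
  shows "(\<integral>\<^sup>+t\<in>{0..2*pi}. k (t + s) \<partial>lborel) = (\<integral>\<^sup>+t\<in>{0..2*pi}. k t \<partial>lborel)"
proof -
  have half: "(\<integral>\<^sup>+t\<in>{0..2*pi}. f t \<partial>lborel) = (\<integral>\<^sup>+t\<in>{0<..2*pi}. f t \<partial>lborel)" for f :: "real \<Rightarrow> ennreal"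
  proof (rule nn_integral_cong_AE)
    show "AE t in lborel. f t * indicator {0..2*pi} t = f t * indicator {0<..2*pi} t"
      using AE_lborel_singleton[of "0::real"] by eventually_elim (auto simp: indicator_def)
  qed
  have "(\<integral>\<^sup>+t\<in>{0<..2*pi}. k (t + s) \<partial>lborel) = (\<integral>\<^sup>+t. k (s + t) * indicator {s<..s+2*pi} (s + t) \<partial>lborel)"
    by (intro nn_integral_cong) (auto simp: indicator_def add.commute)
  also have "\<dots> = (\<integral>\<^sup>+t\<in>{s<..s+2*pi}. k t \<partial>lborel)"
    by (rule nn_integral_lborel_translate) measurable
  also have "\<dots> = (\<integral>\<^sup>+t. k t * indicator {s<..2*pi} t + k t * indicator {2*pi<..s+2*pi} t \<partial>lborel)"
    using s by (intro nn_integral_cong) (auto simp: indicator_def)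
  also have "\<dots> = (\<integral>\<^sup>+t\<in>{s<..2*pi}. k t \<partial>lborel) + (\<integral>\<^sup>+t\<in>{2*pi<..s+2*pi}. k t \<partial>lborel)"
    by (rule nn_integral_add) measurable
  also have "(\<integral>\<^sup>+t\<in>{2*pi<..s+2*pi}. k t \<partial>lborel)
     = (\<integral>\<^sup>+t. k (2*pi + t) * indicator {2*pi<..s+2*pi} (2*pi + t) \<partial>lborel)"
    by (rule nn_integral_lborel_translate[symmetric]) measurable
  also have "\<dots> = (\<integral>\<^sup>+t\<in>{0<..s}. k t \<partial>lborel)"
    using per by (intro nn_integral_cong) (auto simp: indicator_def add.commute)
  also have "(\<integral>\<^sup>+t\<in>{s<..2*pi}. k t \<partial>lborel) + (\<integral>\<^sup>+t\<in>{0<..s}. k t \<partial>lborel)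
     = (\<integral>\<^sup>+t. k t * indicator {s<..2*pi} t + k t * indicator {0<..s} t \<partial>lborel)"
    by (rule nn_integral_add[symmetric]) measurable
  also have "\<dots> = (\<integral>\<^sup>+t\<in>{0<..2*pi}. k t \<partial>lborel)"
    using s by (intro nn_integral_cong) (auto simp: indicator_def)
  finally show ?thesis by (simp add: half)
qed

text \<open>The integral over the disc does not change when the disc is rotated about its centre. Averaging over
  all rotations replaces the value at each point by the mean over the circle through it, where the
  submean inequality applies.\<close>

lemma subharmonic_disc_submean:
  assumes sh: "subharmonic_on S u" and S: "open S" and \<rho>: "0 < \<rho>" "cball c \<rho> \<subseteq> S"
    and neg: "\<And>z. z \<in> cball c \<rho> \<Longrightarrow> u z \<le> 0"
  shows "(\<integral>\<^sup>+z\<in>ball c \<rho>. e2ennreal (- u z) \<partial>lborel) \<le> e2ennreal (- u c) * emeasure lborel (ball c \<rho>)"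
proof -
  define N where "N z = e2ennreal (- (if z \<in> S then u z else -\<infinity>))" for z
  have [measurable]: "N \<in> borel_measurable borel"
  proof -
    have [measurable]: "(\<lambda>z. if z \<in> S then u z else -\<infinity>) \<in> borel_measurable borel"
      using usc_on_borel_measurable[OF S, of u] sh by (simp add: subharmonic_on_def)
    show ?thesis unfolding N_def by measurable
  qed
  have N: "N z = e2ennreal (- u z)" if "z \<in> cball c \<rho>" for z using that \<rho> by (auto simp: N_def)
  have cS: "c \<in> cball c \<rho>" using \<rho> by simp
  have circle: "(\<integral>\<^sup>+t\<in>{0..2*pi}. N (c + of_real r * cis t) \<partial>lborel) \<le> ennreal (2 * pi) * N c"
    if r: "0 < r" "r \<le> \<rho>" for r
  proof -
    have on: "c + of_real r * cis t \<in> cball c \<rho>" for t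
      using r by (simp add: dist_norm norm_mult)
    have P: "(\<integral>\<^sup>+ t \<in> {0..2*pi}. e2ennreal (u (c + of_real r * cis t)) \<partial>lborel) = 0"
      using neg[OF on] by (simp add: e2ennreal_neg)
    define Q where "Q = (\<integral>\<^sup>+ t \<in> {0..2*pi}. N (c + of_real r * cis t) \<partial>lborel)"
    have "u c \<le> circle_mean u c r"
      using sh r \<rho> unfolding subharmonic_on_def by (meson cball_subset_cball_iff dual_order.trans subset_cball)
    also have "\<dots> = - enn2ereal Q / ereal (2 * pi)"
      unfolding circle_mean_def P Q_def N[OF on] by (simp add: zero_ennreal.rep_eq)
    finally have "u c \<le> - enn2ereal Q / ereal (2 * pi)" .
    then have "Q \<le> ennreal (2 * pi) * e2ennreal (- u c)"
    proof (cases "u c")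
      case (real x)
      with \<open>u c \<le> - enn2ereal Q / ereal (2 * pi)\<close> neg[OF cS] show ?thesis
        by (cases Q) (auto simp: enn2ereal_ennreal field_simps ennreal_mult[symmetric] intro!: ennreal_leI)
    qed (use neg[OF cS] in \<open>auto simp: ennreal_mult_top\<close>)
    then show ?thesis by (simp add: Q_def N[OF cS])
  qed
  have rot: "(\<integral>\<^sup>+t\<in>{0..2*pi}. N (c + cis t * \<zeta>) \<partial>lborel) \<le> ennreal (2 * pi) * N c"
    if "cmod \<zeta> \<le> \<rho>" for \<zeta>
  proof (cases "\<zeta> = 0")
    case True
    then show ?thesis by (simp add: nn_integral_cmult mult.commute)
  next
    case False
    define s where "s = Arg2pi \<zeta>"
    have \<zeta>: "\<zeta> = of_real (cmod \<zeta>) * cis s" and s: "0 \<le> s" "s < 2 * pi"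
      using Arg2pi[of \<zeta>] by (auto simp: s_def cis_conv_exp is_Arg_def)
    have "(\<integral>\<^sup>+t\<in>{0..2*pi}. N (c + cis t * \<zeta>) \<partial>lborel)
        = (\<integral>\<^sup>+t\<in>{0..2*pi}. N (c + of_real (cmod \<zeta>) * cis (t + s)) \<partial>lborel)"
    proof -
      have "cis t * \<zeta> = of_real (cmod \<zeta>) * cis (t + s)" for t
        by (subst (1) \<zeta>) (simp add: cis_mult[symmetric] mult_ac)
      then show ?thesis by simp
    qed
    also have "\<dots> = (\<integral>\<^sup>+t\<in>{0..2*pi}. N (c + of_real (cmod \<zeta>) * cis t) \<partial>lborel)"
    proof (rule nn_integral_periodic_shift)
      show "(\<lambda>t. N (c + of_real (cmod \<zeta>) * cis t)) \<in> borel_measurable borel"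
        by (rule measurable_compose[OF _ \<open>N \<in> borel_measurable borel\<close>])
           (intro borel_measurable_continuous_onI continuous_intros)
      show "N (c + of_real (cmod \<zeta>) * cis (t + 2 * pi)) = N (c + of_real (cmod \<zeta>) * cis t)" for t
        by (simp add: cis_mult[symmetric])
    qed (use s in auto)
    also have "\<dots> \<le> ennreal (2 * pi) * N c" using False that by (intro circle) auto
    finally show ?thesis .
  qed
  define B where "B = ball (0::complex) \<rho>"
  have Bm[measurable]: "B \<in> sets borel" by (simp add: B_def)
  have cism[measurable]: "cis \<in> borel_measurable borel"
    by (intro borel_measurable_continuous_onI continuous_intros)
  define I where "I = (\<integral>\<^sup>+\<zeta>. N (c + \<zeta>) * indicator B \<zeta> \<partial>lborel)"
  have Irot: "(\<integral>\<^sup>+\<zeta>. N (c + cis t * \<zeta>) * indicator B \<zeta> \<partial>lborel) = I" for t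
  proof -
    have "(\<integral>\<^sup>+\<zeta>. N (c + cis t * \<zeta>) * indicator B (cis t * \<zeta>) \<partial>lborel) = I"
      unfolding I_def by (rule nn_integral_complex_rotation) (simp, measurable)
    moreover have "indicator B (cis t * \<zeta>) = (indicator B \<zeta> :: ennreal)" for \<zeta>
      by (simp add: B_def indicator_def norm_mult)
    ultimately show ?thesis by simp
  qed
  have "ennreal (2 * pi) * I = (\<integral>\<^sup>+t. I * indicator {0..2*pi} t \<partial>lborel)"
    by (simp add: nn_integral_cmult mult.commute)
  also have "\<dots> = (\<integral>\<^sup>+t. (\<integral>\<^sup>+\<zeta>. N (c + cis t * \<zeta>) * indicator B \<zeta> * indicator {0..2*pi} t \<partial>lborel) \<partial>lborel)"
    by (subst nn_integral_multc) (measurable, simp add: Irot)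
  also have "\<dots> = (\<integral>\<^sup>+\<zeta>. (\<integral>\<^sup>+t. N (c + cis t * \<zeta>) * indicator B \<zeta> * indicator {0..2*pi} t \<partial>lborel) \<partial>lborel)"
    by (rule lborel_pair.Fubini') measurable
  also have "\<dots> \<le> (\<integral>\<^sup>+\<zeta>. ennreal (2 * pi) * N c * indicator B \<zeta> \<partial>lborel)"
  proof (rule nn_integral_mono)
    fix \<zeta>
    show "(\<integral>\<^sup>+t. N (c + cis t * \<zeta>) * indicator B \<zeta> * indicator {0..2*pi} t \<partial>lborel)
       \<le> ennreal (2 * pi) * N c * indicator B \<zeta>"
      using rot[of \<zeta>] by (cases "\<zeta> \<in> B") (auto simp: B_def)
  qed
  also have "\<dots> = ennreal (2 * pi) * (N c * emeasure lborel B)"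
    by (simp add: nn_integral_cmult mult.assoc)
  finally have I: "I \<le> N c * emeasure lborel B"
    by (simp add: ennreal_mult_le_mult_iff)
  have [measurable]: "ball c \<rho> \<in> sets borel" by simp
  have "(\<integral>\<^sup>+z\<in>ball c \<rho>. e2ennreal (- u z) \<partial>lborel) = (\<integral>\<^sup>+z. N z * indicator (ball c \<rho>) z \<partial>lborel)"
    by (intro nn_integral_cong) (auto simp: N indicator_def)
  also have "\<dots> = (\<integral>\<^sup>+\<zeta>. N (c + \<zeta>) * indicator (ball c \<rho>) (c + \<zeta>) \<partial>lborel)"
    by (rule nn_integral_lborel_translate[symmetric]) measurable
  also have "\<dots> = I" unfolding I_def B_def
    by (intro nn_integral_cong) (auto simp: indicator_def dist_norm)
  also note I
  also have "emeasure lborel B = emeasure lborel (ball c \<rho>)" by (simp add: B_def emeasure_ball \<rho> less_imp_le)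
  finally show ?thesis by (simp add: N[OF cS])
qed

section \<open>Integrability at the origin of the plane\<close>

lemma nn_integral_small_ball:
  fixes f :: "'a::euclidean_space \<Rightarrow> ennreal"
  assumes [measurable]: "f \<in> borel_measurable borel" and fin: "(\<integral>\<^sup>+x. f x \<partial>lborel) < \<infinity>" and \<eta>: "\<eta> > 0"
  obtains \<rho>0 where "\<rho>0 > 0" "\<And>\<rho>. \<rho> \<le> \<rho>0 \<Longrightarrow> (\<integral>\<^sup>+x\<in>ball 0 \<rho>. f x \<partial>lborel) < \<eta>"
proof -
  define M where "M = density lborel f"
  define A where "A i = ball (0::'a) (inverse (Suc i))" for i
  have em: "emeasure M X = (\<integral>\<^sup>+x\<in>X. f x \<partial>lborel)" if "X \<in> sets borel" for X
    using that by (simp add: M_def emeasure_density)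
  have dec: "decseq A" unfolding A_def
    by (intro decseq_SucI subset_ball) (simp add: le_imp_inverse_le)
  have inter: "(\<Inter>i. A i) = {0}"
  proof (intro equalityI subsetI)
    fix x assume x: "x \<in> (\<Inter>i. A i)"
    show "x \<in> {0}"
    proof (rule ccontr)
      assume "x \<notin> {0}"
      then obtain n where "inverse (real (Suc n)) < norm x" using reals_Archimedean[of "norm x"] by auto
      moreover have "x \<in> A n" using x by blast
      ultimately show False by (simp add: A_def)
    qed
  qed (simp add: A_def)
  have "(\<lambda>i. emeasure M (A i)) \<longlonglongrightarrow> emeasure M (\<Inter>i. A i)"
  proof (rule Lim_emeasure_decseq[OF _ dec])
    show "range A \<subseteq> sets M" by (auto simp: A_def M_def)
    fix i
    have "emeasure M (A i) \<le> (\<integral>\<^sup>+x. f x \<partial>lborel)"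
      by (subst em) (auto simp: A_def indicator_def intro!: nn_integral_mono)
    then show "emeasure M (A i) \<noteq> \<infinity>" using fin by auto
  qed
  moreover have "emeasure M {0} = 0"
    by (subst em) (auto intro!: nn_integral_null_set finite_imp_null_set_lborel)
  ultimately have "(\<lambda>i. emeasure M (A i)) \<longlonglongrightarrow> 0" by (simp add: inter)
  then have "\<forall>\<^sub>F i in sequentially. emeasure M (A i) < \<eta>" using \<eta> by (rule order_tendstoD)
  then obtain i where i: "emeasure M (A i) < \<eta>" by (auto simp: eventually_sequentially)
  show ?thesis
  proof
    show "inverse (Suc i) > (0::real)" by simp
    fix \<rho> :: real assume "\<rho> \<le> inverse (Suc i)"
    then have "(\<integral>\<^sup>+x\<in>ball 0 \<rho>. f x \<partial>lborel) \<le> emeasure M (A i)"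
      by (subst em) (auto simp: A_def indicator_def intro!: nn_integral_mono)
    then show "(\<integral>\<^sup>+x\<in>ball 0 \<rho>. f x \<partial>lborel) < \<eta>" using i by simp
  qed
qed

lemma eventually_ln_cmod_le: "\<forall>\<^sub>F w in at (0::complex). ln (cmod w) \<le> Z"
proof -
  have "filterlim cmod (at_right 0) (at (0::complex))"
    by (auto simp: filterlim_at tendsto_norm_zero eventually_at_filter)
  from filterlim_compose[OF ln_at_0 this] show ?thesis by (simp add: filterlim_at_bot)
qed

lemma eventually_at_bot_scaled_ln:
  assumes "\<forall>\<^sub>F t in at_bot. P t" and "\<kappa> > 0"
  shows "\<forall>\<^sub>F w in at (0::complex). P (\<kappa> * ln (cmod w) + C)"
proof -
  obtain N where N: "\<And>t. t \<le> N \<Longrightarrow> P t" using assms(1) by (auto simp: eventually_at_bot_linorder)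
  from eventually_ln_cmod_le[of "(N - C) / \<kappa>"] show ?thesis
    by eventually_elim (use assms(2) in \<open>auto intro!: N simp: field_simps\<close>)
qed

lemma eventually_at_0_cmod:
  "eventually P (at (0::complex)) \<longleftrightarrow> (\<exists>d>0. \<forall>w. w \<noteq> 0 \<and> cmod w < d \<longrightarrow> P w)"
  by (auto simp: eventually_at)

text \<open>The function \<open>1 / \<bar>w\<bar>\<^sup>2\<close> is scale invariant in the plane, so an integrable function can dominate a multiple
  of it only on a set of density zero at the origin.\<close>

lemma emeasure_le_of_integrable_inverse_square:
  fixes G :: "complex \<Rightarrow> ennreal"
  assumes G[measurable]: "G \<in> borel_measurable borel" and fin: "(\<integral>\<^sup>+w. G w \<partial>lborel) < \<infinity>"
    and k: "k > 0" and \<theta>: "\<theta> > 0"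
  obtains \<rho>0 where "\<rho>0 > 0"
    "\<And>\<rho> X. \<lbrakk>0 < \<rho>; \<rho> \<le> \<rho>0; X \<in> sets borel; X \<subseteq> ball 0 \<rho> - {0}; \<And>w. w \<in> X \<Longrightarrow> ennreal (k / (cmod w)\<^sup>2) \<le> G w\<rbrakk>
       \<Longrightarrow> emeasure lborel X \<le> ennreal (\<theta> * \<rho>\<^sup>2)"
proof -
  obtain \<rho>0 where \<rho>0: "\<rho>0 > 0" "\<And>\<rho>. \<rho> \<le> \<rho>0 \<Longrightarrow> (\<integral>\<^sup>+x\<in>ball 0 \<rho>. G x \<partial>lborel) < ennreal (k * \<theta>)"
    using nn_integral_small_ball[OF G fin, of "ennreal (k * \<theta>)"] k \<theta> by auto
  show ?thesis
  proof
    show "\<rho>0 > 0" by fact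
    fix \<rho> X
    assume \<rho>: "0 < \<rho>" "\<rho> \<le> \<rho>0" and X[measurable]: "X \<in> sets borel" and sub: "X \<subseteq> ball 0 \<rho> - {0}"
      and low: "\<And>w. w \<in> X \<Longrightarrow> ennreal (k / (cmod w)\<^sup>2) \<le> G w"
    have "ennreal (k / \<rho>\<^sup>2) * emeasure lborel X = (\<integral>\<^sup>+w. ennreal (k / \<rho>\<^sup>2) * indicator X w \<partial>lborel)"
      by (simp add: nn_integral_cmult)
    also have "\<dots> \<le> (\<integral>\<^sup>+w\<in>ball 0 \<rho>. G w \<partial>lborel)"
    proof (rule nn_integral_mono)
      fix w
      show "ennreal (k / \<rho>\<^sup>2) * indicator X w \<le> G w * indicator (ball 0 \<rho>) w"
      proof (cases "w \<in> X")
        case True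
        then have w: "0 < cmod w" "cmod w < \<rho>" using sub by auto
        then have "(cmod w)\<^sup>2 \<le> \<rho>\<^sup>2" by (intro power_mono) auto
        then have "k / \<rho>\<^sup>2 \<le> k / (cmod w)\<^sup>2" using k w(1) \<rho>(1) by (simp add: frac_le)
        then have "ennreal (k / \<rho>\<^sup>2) \<le> G w" using low[OF True] by (meson ennreal_leI order_trans)
        then show ?thesis using True w by simp
      qed simp
    qed
    also have "\<dots> < ennreal (k * \<theta>)" using \<rho> by (intro \<rho>0)
    finally have lt: "ennreal (k / \<rho>\<^sup>2) * emeasure lborel X < ennreal (k * \<theta>)" .
    show "emeasure lborel X \<le> ennreal (\<theta> * \<rho>\<^sup>2)"
    proof (cases "emeasure lborel X")
      case (real x)
      then have "k / \<rho>\<^sup>2 * x < k * \<theta>" using lt k \<rho> by (simp add: ennreal_mult[symmetric] ennreal_less_iff)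
      then have "x < \<theta> * \<rho>\<^sup>2" using k \<rho> by (simp add: field_simps)
      then show ?thesis using real by (simp add: ennreal_leI)
    next
      case top
      then show ?thesis using lt k \<rho> by (simp add: ennreal_mult_top)
    qed
  qed
qed

text \<open>A punctured neighbourhood of the origin does not have density zero there.\<close>

lemma inverse_square_not_integrable:
  fixes G :: "complex \<Rightarrow> ennreal"
  assumes G: "G \<in> borel_measurable borel" "(\<integral>\<^sup>+w. G w \<partial>lborel) < \<infinity>"
    and k: "k > 0" and low: "\<forall>\<^sub>F w in at 0. ennreal (k / (cmod w)\<^sup>2) \<le> G w"
  shows False
proof -
  obtain d where d: "d > 0" "\<And>w. w \<noteq> 0 \<Longrightarrow> cmod w < d \<Longrightarrow> ennreal (k / (cmod w)\<^sup>2) \<le> G w"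
    using low by (auto simp: eventually_at_0_cmod)
  obtain \<rho>0 where \<rho>0: "\<rho>0 > 0"
    "\<And>\<rho> X. \<lbrakk>0 < \<rho>; \<rho> \<le> \<rho>0; X \<in> sets borel; X \<subseteq> ball 0 \<rho> - {0}; \<And>w. w \<in> X \<Longrightarrow> ennreal (k / (cmod w)\<^sup>2) \<le> G w\<rbrakk>
       \<Longrightarrow> emeasure lborel X \<le> ennreal (1 * \<rho>\<^sup>2)"
    using emeasure_le_of_integrable_inverse_square[OF G k zero_less_one] by metis
  define \<rho> where "\<rho> = min \<rho>0 d"
  have \<rho>: "\<rho> > 0" "\<rho> \<le> \<rho>0" "\<rho> \<le> d" using d \<rho>0 by (auto simp: \<rho>_def)
  have "emeasure lborel (ball (0::complex) \<rho> - {0}) = emeasure lborel (ball (0::complex) \<rho>)"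
    by (rule emeasure_Diff_null_set) (auto intro: finite_imp_null_set_lborel)
  also have "\<dots> = ennreal (pi * \<rho>\<^sup>2)" using \<rho> by (simp add: emeasure_ball unit_ball_vol_2)
  finally have eq: "emeasure lborel (ball (0::complex) \<rho> - {0}) = ennreal (pi * \<rho>\<^sup>2)" .
  have "emeasure lborel (ball (0::complex) \<rho> - {0}) \<le> ennreal (1 * \<rho>\<^sup>2)"
    using \<rho> by (intro \<rho>0) (auto intro!: d)
  then have "pi * \<rho>\<^sup>2 \<le> \<rho>\<^sup>2" by (simp add: eq)
  then show False using \<rho> pi_gt3 by simp
qed

text \<open>The sparse set takes up at most a small fraction of the disc of radius \<open>\<bar>w\<bar> / 2\<close> about \<open>w\<close>, and there
  \<open>u \<le> 0\<close> is good enough. On the rest of the disc \<open>u\<close> is at most about \<open>\<kappa> ln \<bar>w\<bar>\<close>; so is its mean, up to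
  a factor close to \<open>1\<close>.\<close>

lemma subharmonic_log_bound_off_sparse_set:
  fixes \<kappa> \<kappa>' :: real
  assumes sh: "subharmonic_on S u" and S: "open S" "0 \<in> S"
    and neg: "\<forall>\<^sub>F w in at 0. u w \<le> 0" and \<kappa>: "0 < \<kappa>'" "\<kappa>' < \<kappa>"
    and sparse: "\<And>\<theta>. \<theta> > 0 \<Longrightarrow> \<exists>\<rho>0>0. \<forall>\<rho>. 0 < \<rho> \<and> \<rho> \<le> \<rho>0 \<longrightarrow>
       emeasure lborel {\<zeta> \<in> ball 0 \<rho> - {0}. ereal (\<kappa> * ln (cmod \<zeta>)) < u \<zeta>} \<le> ennreal (\<theta> * \<rho>\<^sup>2)"
  shows "\<forall>\<^sub>F w in at 0. u w \<le> ereal (\<kappa>' * ln (cmod w))"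
proof -
  define \<kappa>'' where "\<kappa>'' = (\<kappa> + \<kappa>') / 2"
  have \<kappa>'': "\<kappa>' < \<kappa>''" "\<kappa>'' < \<kappa>" "\<kappa>'' > 0" using \<kappa> by (auto simp: \<kappa>''_def)
  \<comment> \<open>The sparse part of the disc has area at most \<open>4 \<theta> s\<^sup>2\<close> out of \<open>pi s\<^sup>2 / 4\<close>, so it costs the factor
    \<open>1 - 16 \<theta> / pi\<close>, which is made equal to \<open>\<kappa>'' / \<kappa>\<close>. The gap from \<open>\<kappa>''\<close> to \<open>\<kappa>'\<close> absorbs \<open>ln 2\<close>.\<close>
  define \<theta> where "\<theta> = pi / 16 * (1 - \<kappa>'' / \<kappa>)"
  have \<theta>: "\<theta> > 0" using \<kappa> \<kappa>'' by (simp add: \<theta>_def field_simps)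
  obtain \<rho>0 where \<rho>0: "\<rho>0 > 0" "\<And>\<rho>. 0 < \<rho> \<Longrightarrow> \<rho> \<le> \<rho>0 \<Longrightarrow>
       emeasure lborel {\<zeta> \<in> ball 0 \<rho> - {0}. ereal (\<kappa> * ln (cmod \<zeta>)) < u \<zeta>} \<le> ennreal (\<theta> * \<rho>\<^sup>2)"
    using sparse[OF \<theta>] by auto
  obtain d where d: "d > 0" "\<And>w. w \<noteq> 0 \<Longrightarrow> cmod w < d \<Longrightarrow> u w \<le> 0"
    using neg by (auto simp: eventually_at_0_cmod)
  obtain e where e: "e > 0" "ball 0 e \<subseteq> S" using S by (meson openE)
  define R where "R = min (min \<rho>0 d) (min e 1) / 2"
  have R: "R > 0" "2 * R \<le> \<rho>0" "2 * R \<le> d" "2 * R \<le> e" "2 * R \<le> 1"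
    using \<rho>0 d e by (auto simp: R_def)
  have [measurable]: "(\<lambda>z. if z \<in> S then u z else -\<infinity>) \<in> borel_measurable borel"
    using usc_on_borel_measurable[OF S(1), of u] sh by (simp add: subharmonic_on_def)
  have "\<forall>\<^sub>F w in at (0::complex). cmod w < R \<and> w \<noteq> 0"
    using R(1) by (auto simp: eventually_at_0_cmod)
  moreover have "\<forall>\<^sub>F w in at (0::complex). ln (cmod w) \<le> - \<kappa>'' * ln 2 / (\<kappa>'' - \<kappa>')"
    by (rule eventually_ln_cmod_le)
  ultimately show ?thesis
  proof eventually_elim
    case (elim w)
    define s where "s = cmod w"
    have s: "0 < s" "s < R" using elim by (auto simp: s_def)
    define l where "l = - (\<kappa> * ln (2 * s))"
    have l: "l > 0" using s R(5) \<kappa> by (simp add: l_def mult_pos_neg)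
    define D where "D = ball w (s / 2)"
    define Bad where "Bad = {\<zeta> \<in> ball 0 (2 * s) - {0}. ereal (\<kappa> * ln (cmod \<zeta>)) < u \<zeta>}"
    have inD: "\<zeta> \<noteq> 0 \<and> cmod \<zeta> < 2 * s" if "\<zeta> \<in> cball w (s / 2)" for \<zeta>
    proof -
      have "cmod (w - \<zeta>) \<le> s / 2" using that by (simp add: dist_norm)
      then have "0 < cmod \<zeta>" "cmod \<zeta> < 2 * s"
        using norm_triangle_ineq2[of w \<zeta>] norm_triangle_ineq2[of \<zeta> w] s
        unfolding s_def norm_minus_commute[of \<zeta> w] by linarith+
      then show ?thesis by simp
    qed
    have cbS: "cball w (s / 2) \<subseteq> S" using inD s R e by force
    have sub: "(\<integral>\<^sup>+z\<in>D. e2ennreal (- u z) \<partial>lborel) \<le> e2ennreal (- u w) * emeasure lborel D"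
      unfolding D_def
    proof (rule subharmonic_disc_submean[OF sh S(1) _ cbS])
      fix z assume "z \<in> cball w (s / 2)"
      then show "u z \<le> 0" using inD[of z] s R by (intro d) auto
    qed (use s in simp)
    have Dm[measurable]: "D \<in> sets borel" by (simp add: D_def)
    have Bad_eq: "Bad = {\<zeta>. ereal (\<kappa> * ln (cmod \<zeta>)) < (if \<zeta> \<in> S then u \<zeta> else -\<infinity>)} \<inter> (ball 0 (2 * s) - {0})"
      using s R e by (force simp: Bad_def)
    have Bm[measurable]: "Bad \<in> sets borel"
      unfolding Bad_eq
    proof (rule sets.Int)
      have "{\<zeta> \<in> space borel. ereal (\<kappa> * ln (cmod \<zeta>)) < (if \<zeta> \<in> S then u \<zeta> else -\<infinity>)} \<in> sets borel"
        by measurable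
      then show "{\<zeta>. ereal (\<kappa> * ln (cmod \<zeta>)) < (if \<zeta> \<in> S then u \<zeta> else -\<infinity>)} \<in> sets borel" by simp
    qed auto
    have emD: "emeasure lborel D = ennreal (pi * (s / 2)\<^sup>2)"
      using s by (simp add: D_def emeasure_ball unit_ball_vol_2)
    have emB: "emeasure lborel Bad \<le> ennreal (\<theta> * (2 * s)\<^sup>2)"
      unfolding Bad_def using s R by (intro \<rho>0) auto
    have "ennreal l * emeasure lborel D \<le> ennreal l * (emeasure lborel (D - Bad) + emeasure lborel Bad)"
    proof (intro mult_left_mono)
      have "emeasure lborel D \<le> emeasure lborel ((D - Bad) \<union> Bad)" by (intro emeasure_mono) auto
      also have "\<dots> \<le> emeasure lborel (D - Bad) + emeasure lborel Bad" by (intro emeasure_subadditive) auto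
      finally show "emeasure lborel D \<le> emeasure lborel (D - Bad) + emeasure lborel Bad" .
    qed simp
    also have "\<dots> \<le> e2ennreal (- u w) * emeasure lborel D + ennreal l * ennreal (\<theta> * (2 * s)\<^sup>2)"
      unfolding distrib_left
    proof (intro add_mono mult_left_mono emB)
      have "ennreal l * emeasure lborel (D - Bad) = (\<integral>\<^sup>+z. ennreal l * indicator (D - Bad) z \<partial>lborel)"
        by (simp add: nn_integral_cmult)
      also have "\<dots> \<le> (\<integral>\<^sup>+z\<in>D. e2ennreal (- u z) \<partial>lborel)"
      proof (rule nn_integral_mono)
        fix z
        show "ennreal l * indicator (D - Bad) z \<le> e2ennreal (- u z) * indicator D z"
        proof (cases "z \<in> D - Bad")
          case True
          then have z: "z \<noteq> 0" "cmod z < 2 * s" using inD[of z] by (auto simp: D_def)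
          then have "u z \<le> ereal (\<kappa> * ln (cmod z))" using True by (auto simp: Bad_def)
          also have "\<dots> \<le> ereal (- l)"
          proof -
            have "ln (cmod z) \<le> ln (2 * s)" using z s by (subst ln_le_cancel_iff) auto
            then show ?thesis using \<kappa> by (simp add: l_def)
          qed
          finally have "ereal l \<le> - u z" by (cases "u z") auto
          from e2ennreal_mono[OF this] True show ?thesis by simp
        qed simp
      qed
      finally show "ennreal l * emeasure lborel (D - Bad) \<le> e2ennreal (- u w) * emeasure lborel D"
        using sub by simp
    qed simp
    finally have key: "ennreal l * emeasure lborel D
       \<le> e2ennreal (- u w) * emeasure lborel D + ennreal l * ennreal (\<theta> * (2 * s)\<^sup>2)" .
    have uw: "u w \<le> 0" using elim R by (intro d) auto
    have "u w \<le> ereal (\<kappa>'' * ln (2 * s))"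
    proof (cases "u w")
      case (real x)
      have x: "x \<le> 0" using uw real by simp
      define p q where "p = pi * (s / 2)\<^sup>2" and "q = \<theta> * (2 * s)\<^sup>2"
      have nn: "0 \<le> p" "0 \<le> q" "0 \<le> - x" "0 \<le> l" using x l \<theta> by (auto simp: p_def q_def)
      have "ennreal (l * p) \<le> ennreal (- x * p + l * q)"
        using key nn unfolding emD real p_def[symmetric] q_def[symmetric]
        by (simp only: uminus_ereal.simps e2ennreal_ereal ennreal_mult ennreal_plus mult_nonneg_nonneg)
      then have "l * p \<le> - x * p + l * q"
        using nn by (subst (asm) ennreal_le_iff) (intro add_nonneg_nonneg mult_nonneg_nonneg, auto)
      then have "l * (pi * (s / 2)\<^sup>2) \<le> - x * (pi * (s / 2)\<^sup>2) + l * (\<theta> * (2 * s)\<^sup>2)"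
        by (simp add: p_def q_def)
      then have "s\<^sup>2 * (l * (pi / 4)) \<le> s\<^sup>2 * (- x * (pi / 4) + l * (4 * \<theta>))"
        by (simp add: power2_eq_square algebra_simps)
      then have "l * (pi / 4) \<le> - x * (pi / 4) + l * (4 * \<theta>)"
        using s by (subst (asm) mult_le_cancel_left_pos) auto
      then have "(pi / 4) * x \<le> (pi / 4) * (- l * (\<kappa>'' / \<kappa>))"
        by (simp add: \<theta>_def algebra_simps)
      then have "x \<le> - l * (\<kappa>'' / \<kappa>)" by (rule mult_left_le_imp_le) simp
      also have "\<dots> = \<kappa>'' * ln (2 * s)" using \<kappa> by (simp add: l_def)
      finally show ?thesis using real by simp
    qed (use uw in auto)
    also have "ereal (\<kappa>'' * ln (2 * s)) \<le> ereal (\<kappa>' * ln s)"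
    proof -
      have "ln s * (\<kappa>'' - \<kappa>') \<le> - \<kappa>'' * ln 2"
        using elim(2) \<kappa>''(1) unfolding s_def by (subst (asm) pos_le_divide_eq) simp_all
      then show ?thesis using s by (simp add: ln_mult algebra_simps)
    qed
    finally show ?case by (simp add: s_def)
  qed
qed

section \<open>Comparison of the two exponentials on a complex line\<close>

lemma ereal_exp_ereal: "ereal_exp (- 2 * ereal x) = ereal (exp (- 2 * x))"
  by (simp add: ereal_exp_def)

lemma ereal_exp_MInf: "ereal_exp (- 2 * (-\<infinity>)) = \<infinity>"
  by (simp add: ereal_exp_def)

lemma extend_minf_ereal: "extend_minf g (ereal t) = ereal (g t)"
  by (simp add: extend_minf_def)

lemma extend_minf_MInf:
  assumes "filterlim g at_bot at_bot"
  shows "extend_minf g (-\<infinity>) = -\<infinity>"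
proof -
  have "((\<lambda>t. ereal (g t)) \<longlongrightarrow> -\<infinity>) at_bot"
    using assms by (simp add: tendsto_MInfty filterlim_at_bot_dense)
  then show ?thesis by (simp add: extend_minf_def tendsto_Lim trivial_limit_at_bot_linorder)
qed

text \<open>In one variable the smallest vanishing order \<open>p\<close> among the \<open>f k\<close> governs the singularity: the quotient
  of the sum of squares by \<open>\<bar>w\<bar>^(2p)\<close> has a positive limit. If all the \<open>f k\<close> vanish, the function is
  \<open>-\<infinity>\<close>.\<close>

lemma analytic_singularity_log_form:
  assumes "analytic_singularities_on S v" "0 \<in> S"
  shows "(\<forall>\<^sub>F w in at 0. v w = -\<infinity>) \<or>
    (\<exists>a M. \<forall>\<^sub>F w in at 0. \<exists>x. v w = ereal x \<and> \<bar>x - a * ln (cmod w)\<bar> \<le> M)"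
proof -
  obtain W and c :: real and m :: nat and f :: "nat \<Rightarrow> complex \<Rightarrow> complex" and M :: real where
    sing: "open W \<and> 0 \<in> W \<and> W \<subseteq> S \<and> 0 < c \<and> 1 \<le> m \<and> (\<forall>k\<in>{1..m}. f k holomorphic_on W) \<and>
        (\<forall>z\<in>W.
           v z \<le> ereal (c / 2) * ereal_log (\<Sum>k=1..m. (cmod (f k z))\<^sup>2) + ereal M \<and>
           ereal (c / 2) * ereal_log (\<Sum>k=1..m. (cmod (f k z))\<^sup>2) \<le> v z + ereal M)"
    using assms unfolding analytic_singularities_on_def by (elim conjE) (drule (1) bspec, elim exE, rule that)
  have W: "open W" "0 \<in> W" and c: "0 < c" and hol: "\<And>k. k \<in> {1..m} \<Longrightarrow> f k holomorphic_on W"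
    and upper: "\<And>z. z \<in> W \<Longrightarrow> v z \<le> ereal (c / 2) * ereal_log (\<Sum>k=1..m. (cmod (f k z))\<^sup>2) + ereal M"
    and lower: "\<And>z. z \<in> W \<Longrightarrow> ereal (c / 2) * ereal_log (\<Sum>k=1..m. (cmod (f k z))\<^sup>2) \<le> v z + ereal M"
    using sing by simp_all
  obtain r where r: "r > 0" "ball 0 r \<subseteq> W" using W by (meson openE)
  have ev_ball: "\<forall>\<^sub>F z in at 0. z \<in> ball (0::complex) r \<and> z \<noteq> 0"
    using r(1) by (auto simp: eventually_at_0_cmod)
  define Z where "Z = {k \<in> {1..m}. \<forall>z \<in> ball 0 r. f k z = 0}"
  have order: "\<exists>p L. L > 0 \<and> ((\<lambda>z. (cmod (f k z))\<^sup>2 / cmod z ^ (2 * p)) \<longlongrightarrow> L) (at 0)"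
    if k: "k \<in> {1..m} - Z" for k
  proof (cases "f k 0 = 0")
    case False
    have "isCont (f k) 0"
      by (rule field_differentiable_imp_continuous_at, rule holomorphic_on_imp_differentiable_at[OF hol W])
         (use k in simp)
    then have "((\<lambda>z. (cmod (f k z))\<^sup>2 / cmod z ^ (2 * 0)) \<longlongrightarrow> (cmod (f k 0))\<^sup>2 / 1) (at 0)"
      by (intro tendsto_intros) (auto simp: isCont_def)
    then show ?thesis using False by (intro exI[of _ 0] exI[of _ "(cmod (f k 0))\<^sup>2"]) auto
  next
    case True
    obtain z0 where z0: "z0 \<in> ball 0 r" "f k z0 \<noteq> 0" using k by (auto simp: Z_def)
    have nc: "\<not> f k constant_on ball 0 r"
    proof
      assume "f k constant_on ball 0 r"
      then obtain y where "\<And>z. z \<in> ball 0 r \<Longrightarrow> f k z = y" by (auto simp: constant_on_def)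
      from this[of 0] this[of z0] z0 True r(1) show False by simp
    qed
    have hf: "f k holomorphic_on ball 0 r" by (rule holomorphic_on_subset[OF hol r(2)]) (use k in simp)
    have c0: "(0::complex) \<in> ball 0 r" using r(1) by simp
    show ?thesis
    proof (rule holomorphic_factor_zero_nonconstant[OF hf open_ball connected_ball c0 True nc])
      fix h \<rho> n
      assume h: "0 < n" "0 < \<rho>" "ball 0 \<rho> \<subseteq> ball 0 r" "h holomorphic_on ball 0 \<rho>"
        "\<And>w. w \<in> ball 0 \<rho> \<Longrightarrow> f k w = (w - 0) ^ n * h w" "\<And>w. w \<in> ball 0 \<rho> \<Longrightarrow> h w \<noteq> 0"
      have "isCont h 0"
        by (rule field_differentiable_imp_continuous_at, rule holomorphic_on_imp_differentiable_at[OF h(4)])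
           (use h(2) in auto)
      then have "((\<lambda>z. (cmod (h z))\<^sup>2) \<longlongrightarrow> (cmod (h 0))\<^sup>2) (at 0)"
        by (intro tendsto_intros) (auto simp: isCont_def)
      then have "((\<lambda>z. (cmod (f k z))\<^sup>2 / cmod z ^ (2 * n)) \<longlongrightarrow> (cmod (h 0))\<^sup>2) (at 0)"
      proof (rule Lim_transform_eventually)
        have "\<forall>\<^sub>F z in at (0::complex). cmod z < \<rho> \<and> z \<noteq> 0"
          using h(2) by (auto simp: eventually_at_0_cmod)
        then show "\<forall>\<^sub>F z in at 0. (cmod (h z))\<^sup>2 = (cmod (f k z))\<^sup>2 / cmod z ^ (2 * n)"
        proof eventually_elim
          case (elim z)
          then have "f k z = z ^ n * h z" using h(5)[of z] by simp
          then have "(cmod (f k z))\<^sup>2 = cmod z ^ (2 * n) * (cmod (h z))\<^sup>2"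
            by (simp add: norm_mult norm_power power_mult_distrib power_mult[symmetric] mult.commute)
          then show ?case using elim by simp
        qed
      qed
      moreover have "(cmod (h 0))\<^sup>2 > 0" using h(2) h(6)[of 0] by simp
      ultimately show ?thesis by blast
    qed
  qed
  show ?thesis
  proof (cases "{1..m} - Z = {}")
    case True
    from ev_ball have "\<forall>\<^sub>F w in at 0. v w = -\<infinity>"
    proof eventually_elim
      case (elim w)
      have "(\<Sum>k=1..m. (cmod (f k w))\<^sup>2) = 0"
        using True elim by (intro sum.neutral) (auto simp: Z_def)
      then have "v w \<le> -\<infinity>" using upper[of w] r(2) elim c by (auto simp: ereal_log_def)
      then show ?case by simp
    qed
    then show ?thesis ..
  next
    case False
    obtain P L where PL: "\<And>k. k \<in> {1..m} - Z \<Longrightarrow> L k > 0"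
      "\<And>k. k \<in> {1..m} - Z \<Longrightarrow> ((\<lambda>z. (cmod (f k z))\<^sup>2 / cmod z ^ (2 * P k)) \<longlongrightarrow> L k) (at 0)"
      using order by metis
    define p where "p = Min (P ` ({1..m} - Z))"
    have p_le: "p \<le> P k" if "k \<in> {1..m} - Z" for k using that by (simp add: p_def)
    have "p \<in> P ` ({1..m} - Z)" unfolding p_def using False by (intro Min_in) auto
    then obtain k0 where k0: "k0 \<in> {1..m} - Z" "P k0 = p" by auto
    \<comment> \<open>The power \<open>0 ^ (2 * (P k - p))\<close> is \<open>1\<close> for the \<open>f k\<close> of smallest order and \<open>0\<close> for the others.\<close>
    define L' where "L' k = (if k \<in> Z then 0 else L k * 0 ^ (2 * (P k - p)))" for k
    define \<Lambda> where "\<Lambda> = (\<Sum>k=1..m. L' k)"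
    have "L' k \<ge> 0" if "k \<in> {1..m}" for k using that PL(1)[of k] by (auto simp: L'_def)
    moreover have "L' k0 > 0" using k0 PL(1)[of k0] by (auto simp: L'_def)
    ultimately have \<Lambda>: "\<Lambda> > 0" unfolding \<Lambda>_def using k0(1) by (intro sum_pos2[of _ k0]) auto
    have "((\<lambda>z. \<Sum>k=1..m. (cmod (f k z))\<^sup>2 / cmod z ^ (2 * p)) \<longlongrightarrow> \<Lambda>) (at 0)"
      unfolding \<Lambda>_def
    proof (rule tendsto_sum)
      fix k assume k: "k \<in> {1..m}"
      show "((\<lambda>z. (cmod (f k z))\<^sup>2 / cmod z ^ (2 * p)) \<longlongrightarrow> L' k) (at 0)"
      proof (cases "k \<in> Z")
        case True
        from ev_ball have "\<forall>\<^sub>F z in at 0. 0 = (cmod (f k z))\<^sup>2 / cmod z ^ (2 * p)"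
          by eventually_elim (use True in \<open>auto simp: Z_def\<close>)
        from Lim_transform_eventually[OF tendsto_const this] True show ?thesis by (simp add: L'_def)
      next
        case kZ: False
        then have k': "k \<in> {1..m} - Z" using k by simp
        have lim: "((\<lambda>z. (cmod (f k z))\<^sup>2 / cmod z ^ (2 * P k) * cmod z ^ (2 * (P k - p)))
           \<longlongrightarrow> L k * cmod 0 ^ (2 * (P k - p))) (at 0)"
          by (intro tendsto_intros PL(2) k')
        have "\<forall>\<^sub>F z in at 0. (cmod (f k z))\<^sup>2 / cmod z ^ (2 * P k) * cmod z ^ (2 * (P k - p))
            = (cmod (f k z))\<^sup>2 / cmod z ^ (2 * p)"
          using ev_ball
        proof eventually_elim
          case (elim z)
          have "cmod z ^ (2 * P k) = cmod z ^ (2 * (P k - p)) * cmod z ^ (2 * p)"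
          proof -
            have "2 * P k = 2 * (P k - p) + 2 * p" using p_le[OF k'] by simp
            then show ?thesis by (metis power_add)
          qed
          then show ?case using elim by simp
        qed
        from Lim_transform_eventually[OF lim this] kZ show ?thesis by (simp add: L'_def)
      qed
    qed
    then have lim: "((\<lambda>z. (\<Sum>k=1..m. (cmod (f k z))\<^sup>2) / cmod z ^ (2 * p)) \<longlongrightarrow> \<Lambda>) (at 0)"
      by (simp add: sum_divide_distrib)
    have e1: "\<forall>\<^sub>F z in at 0. \<Lambda> / 2 < (\<Sum>k=1..m. (cmod (f k z))\<^sup>2) / cmod z ^ (2 * p)"
      using \<Lambda> by (intro order_tendstoD(1)[OF lim]) simp
    have e2: "\<forall>\<^sub>F z in at 0. (\<Sum>k=1..m. (cmod (f k z))\<^sup>2) / cmod z ^ (2 * p) < 2 * \<Lambda>"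
      using \<Lambda> by (intro order_tendstoD(2)[OF lim]) simp
    define B where "B = max \<bar>ln (\<Lambda> / 2)\<bar> \<bar>ln (2 * \<Lambda>)\<bar>"
    have "\<forall>\<^sub>F w in at 0. \<exists>x. v w = ereal x \<and> \<bar>x - (c * p) * ln (cmod w)\<bar> \<le> M + c / 2 * B"
      using e1 e2 ev_ball
    proof eventually_elim
      case (elim w)
      define \<sigma> where "\<sigma> = (\<Sum>k=1..m. (cmod (f k w))\<^sup>2)"
      define \<tau> where "\<tau> = \<sigma> / cmod w ^ (2 * p)"
      have \<tau>: "\<Lambda> / 2 < \<tau>" "\<tau> < 2 * \<Lambda>" "\<tau> > 0" using elim \<Lambda> by (auto simp: \<tau>_def \<sigma>_def)
      have cw: "cmod w > 0" using elim by simp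
      have \<sigma>: "\<sigma> = \<tau> * cmod w ^ (2 * p)" using cw by (simp add: \<tau>_def)
      have "\<sigma> > 0" using \<tau> cw by (simp add: \<sigma>)
      have ln\<sigma>: "ln \<sigma> = ln \<tau> + 2 * p * ln (cmod w)"
        using \<tau>(3) cw by (simp add: \<sigma> ln_mult ln_realpow)
      have "ln (\<Lambda> / 2) \<le> ln \<tau>" "ln \<tau> \<le> ln (2 * \<Lambda>)" using \<tau> \<Lambda> by simp_all
      then have "\<bar>ln \<tau>\<bar> \<le> B" by (auto simp: B_def)
      then have "c / 2 * \<bar>ln \<tau>\<bar> \<le> c / 2 * B" using c by (intro mult_left_mono) auto
      then have B: "\<bar>c / 2 * ln \<tau>\<bar> \<le> c / 2 * B" using c by (simp add: abs_mult)
      have wW: "w \<in> W" using elim r by auto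
      have up: "v w \<le> ereal (c / 2 * ln \<sigma> + M)" and lo: "ereal (c / 2 * ln \<sigma>) \<le> v w + ereal M"
        using upper[OF wW] lower[OF wW] \<open>\<sigma> > 0\<close> by (auto simp: ereal_log_def \<sigma>_def)
      then obtain x where x: "v w = ereal x" by (cases "v w") auto
      have "x \<le> c / 2 * ln \<sigma> + M" "c / 2 * ln \<sigma> \<le> x + M" using up lo by (auto simp: x)
      moreover have "c / 2 * ln \<sigma> = c / 2 * ln \<tau> + c * p * ln (cmod w)"
        by (simp add: ln\<sigma> algebra_simps)
      ultimately have "\<bar>x - (c * p) * ln (cmod w)\<bar> \<le> M + c / 2 * B" using B by linarith
      then show ?case using x by blast
    qed
    then show ?thesis by blast
  qed
qed

text \<open>This is the one-variable core of the argument. The weight \<open>\<bar>w\<bar>^(2n) / \<bar>w\<bar>\<^sup>2\<close> is the density that a line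
  through the origin inherits from the \<open>n\<close>-dimensional integral.\<close>

lemma line_comparison_contradiction:
  fixes g :: "real \<Rightarrow> real" and n :: nat and u A :: "complex \<Rightarrow> ereal"
  assumes conv: "convex_on UNIV g" and mg: "mono g" and lim: "deriv_tendsto_at_bot g C0" and C0: "C0 > 0"
    and hbot: "filterlim (\<lambda>t. g t - C0 * t) at_bot at_bot" and gbot: "filterlim g at_bot at_bot"
    and sh: "subharmonic_on S u" and S: "open S" "0 \<in> S" and n: "n \<ge> 1"
    and ev: "\<And>\<epsilon>. \<epsilon> > 0 \<Longrightarrow> \<forall>\<^sub>F w in at 0. u w \<le> ereal ((n / C0 - \<epsilon>) * ln (cmod w))"
    and A: "\<forall>\<^sub>F w in at 0. \<exists>x. A w = ereal x \<and> \<bar>x - a * ln (cmod w)\<bar> \<le> M"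
    and G: "G \<in> borel_measurable borel" "(\<integral>\<^sup>+w. G w \<partial>lborel) < \<infinity>"
    and GD: "\<forall>\<^sub>F w in at 0. ennreal (cmod w ^ (2 * n) / (cmod w)\<^sup>2)
       * e2ennreal \<bar>ereal_exp (- 2 * extend_minf g (u w)) - ereal_exp (- 2 * A w)\<bar> \<le> G w"
  shows False
proof -
  define b where "b = max a n"
  define \<alpha> where "\<alpha> = b / C0"
  have b: "b \<ge> n" "b \<ge> a" "b > 0" using n by (auto simp: b_def)
  have \<alpha>: "\<alpha> > 0" "C0 * \<alpha> = b" using b C0 by (auto simp: \<alpha>_def)
  define D where "D w = e2ennreal \<bar>ereal_exp (- 2 * extend_minf g (u w)) - ereal_exp (- 2 * A w)\<bar>" for w
  have ev1: "\<forall>\<^sub>F w in at (0::complex). w \<noteq> 0 \<and> cmod w < 1"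
    by (auto simp: eventually_at_0_cmod intro: exI[of _ 1])
  \<comment> \<open>As \<open>b \<ge> n\<close>, a lower bound of order \<open>\<bar>w\<bar>^(-2b)\<close> for the difference outweighs the factor
    \<open>\<bar>w\<bar>^(2n)\<close>.\<close>
  have G_lower: "ennreal (k / (cmod w)\<^sup>2) \<le> G w"
    if k: "k \<ge> 0" "ennreal (k * exp (- 2 * b * ln (cmod w))) \<le> D w" and w: "w \<noteq> 0" "cmod w < 1"
      and GDw: "ennreal (cmod w ^ (2 * n) / (cmod w)\<^sup>2) * D w \<le> G w" for k w
  proof -
    have cw: "cmod w > 0" using w by simp
    have "1 \<le> exp (2 * (n - b) * ln (cmod w))"
      using b(1) w by (simp add: mult_nonpos_nonpos)
    also have "\<dots> = cmod w ^ (2 * n) * exp (- 2 * b * ln (cmod w))"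
    proof -
      have "cmod w ^ (2 * n) = exp (2 * n * ln (cmod w))"
        using cw by (metis exp_ln exp_of_nat_mult of_nat_mult of_nat_numeral)
      then show ?thesis by (simp add: exp_add[symmetric] algebra_simps)
    qed
    finally have 1: "1 \<le> cmod w ^ (2 * n) * exp (- 2 * b * ln (cmod w))" .
    have "k / (cmod w)\<^sup>2 \<le> cmod w ^ (2 * n) / (cmod w)\<^sup>2 * (k * exp (- 2 * b * ln (cmod w)))"
      using mult_left_mono[OF 1, of "k / (cmod w)\<^sup>2"] k(1) by (simp add: field_simps)
    then have "ennreal (k / (cmod w)\<^sup>2)
       \<le> ennreal (cmod w ^ (2 * n) / (cmod w)\<^sup>2) * ennreal (k * exp (- 2 * b * ln (cmod w)))"
      using k(1) by (subst ennreal_mult[symmetric]) (auto intro!: ennreal_leI)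
    also have "\<dots> \<le> ennreal (cmod w ^ (2 * n) / (cmod w)\<^sup>2) * D w"
      by (intro mult_left_mono k(2)) simp
    finally show ?thesis using GDw by simp
  qed
  have u_neg: "\<forall>\<^sub>F w in at 0. u w \<le> 0"
  proof -
    have "n / (2 * C0) > 0" using n C0 by simp
    from ev[OF this] ev1 show ?thesis
    proof eventually_elim
      case (elim w)
      have "(n / C0 - n / (2 * C0)) * ln (cmod w) \<le> 0"
        using elim n C0 by (intro mult_nonneg_nonpos) (auto simp: field_simps)
      then have "ereal ((n / C0 - n / (2 * C0)) * ln (cmod w)) \<le> 0" by simp
      with elim(1) show ?case by (rule order_trans)
    qed
  qed
  have step1: "\<forall>\<^sub>F w in at 0. u w \<le> ereal ((\<alpha> - \<epsilon>) * ln (cmod w))" if \<epsilon>: "\<epsilon> > 0" for \<epsilon>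
  proof (cases "a \<le> n")
    case True
    then show ?thesis using ev[OF \<epsilon>] by (simp add: \<alpha>_def b_def)
  next
    case False
    then have ab: "a = b" by (simp add: b_def)
    \<comment> \<open>Where \<open>g t \<ge> (C0 + \<eta>) t\<close>, a value \<open>u > \<kappa> ln \<bar>w\<bar>\<close> forces \<open>g(u) \<ge> (b - \<xi>) ln \<bar>w\<bar>\<close>; the positive
      \<open>\<xi>\<close> makes \<open>exp (-2 g(u))\<close> negligible against \<open>\<bar>w\<bar>^(-2b)\<close>. The constant \<open>k\<close> is half of the factor
      \<open>exp (-2M)\<close> in the lower bound for the second exponential.\<close>
    define \<epsilon>' where "\<epsilon>' = min \<epsilon> (\<alpha> / 2)"
    define \<kappa> where "\<kappa> = \<alpha> - \<epsilon>' / 2"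
    define \<xi> where "\<xi> = C0 * \<epsilon>' / 4"
    define \<eta> where "\<eta> = C0 * \<epsilon>' / (4 * \<alpha>)"
    have \<epsilon>': "\<epsilon>' > 0" "\<epsilon>' \<le> \<epsilon>" "\<epsilon>' \<le> \<alpha> / 2" using \<epsilon> \<alpha> by (auto simp: \<epsilon>'_def)
    have \<kappa>: "\<kappa> > 0" "\<kappa> \<le> \<alpha>" and \<xi>: "\<xi> > 0" and \<eta>: "\<eta> > 0"
      using \<epsilon>' \<alpha> C0 by (auto simp: \<kappa>_def \<xi>_def \<eta>_def)
    have "\<eta> * \<kappa> \<le> \<eta> * \<alpha>" using \<eta> \<kappa> by (intro mult_left_mono) auto
    also have "\<eta> * \<alpha> = \<xi>" using \<alpha> by (simp add: \<eta>_def \<xi>_def)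
    finally have slope: "(C0 + \<eta>) * \<kappa> \<le> b - \<xi>"
      using \<alpha>(2) by (simp add: \<kappa>_def \<xi>_def algebra_simps)
    define k where "k = exp (- 2 * M) / 2"
    have k: "k > 0" by (simp add: k_def)
    have "\<forall>\<^sub>F w in at 0. ereal (\<kappa> * ln (cmod w)) < u w \<longrightarrow> ennreal (k / (cmod w)\<^sup>2) \<le> G w"
      using eventually_at_bot_scaled_ln[OF convex_lower_asymptote[OF conv lim \<eta>] \<kappa>(1), of 0]
        eventually_ln_cmod_le[of "ln k / (2 * \<xi>)"] A GD ev1 u_neg
    proof eventually_elim
      case (elim w)
      show ?case
      proof
        assume gt: "ereal (\<kappa> * ln (cmod w)) < u w"
        obtain t where t: "u w = ereal t" using gt elim(6) by (cases "u w") auto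
        obtain x where x: "A w = ereal x" "\<bar>x - a * ln (cmod w)\<bar> \<le> M" using elim(3) by auto
        have lneg: "ln (cmod w) < 0" using elim(5) by simp
        have "(b - \<xi>) * ln (cmod w) \<le> (C0 + \<eta>) * \<kappa> * ln (cmod w)"
          using slope lneg by (intro mult_right_mono_neg) auto
        also have "\<dots> \<le> g (\<kappa> * ln (cmod w))" using elim(1) by (simp add: mult.assoc)
        also have "\<dots> \<le> g t" using gt t by (intro monoD[OF mg]) auto
        finally have gt: "(b - \<xi>) * ln (cmod w) \<le> g t" .
        have "exp (- 2 * g t) \<le> exp (2 * \<xi> * ln (cmod w) - 2 * b * ln (cmod w))"
          using gt by (simp add: algebra_simps)
        also have "\<dots> = exp (2 * \<xi> * ln (cmod w)) * exp (- 2 * b * ln (cmod w))"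
          by (simp add: exp_add[symmetric])
        also have "\<dots> \<le> k * exp (- 2 * b * ln (cmod w))"
        proof (intro mult_right_mono)
          have "2 * \<xi> * ln (cmod w) \<le> ln k" using elim(2) \<xi> by (simp add: field_simps)
          then show "exp (2 * \<xi> * ln (cmod w)) \<le> k" using k by (metis exp_le_cancel_iff exp_ln)
        qed simp
        finally have E1: "exp (- 2 * g t) \<le> k * exp (- 2 * b * ln (cmod w))" .
        have "- 2 * M + - 2 * b * ln (cmod w) \<le> - 2 * x" using x(2) ab by (simp add: abs_le_iff)
        then have "exp (- 2 * M + - 2 * b * ln (cmod w)) \<le> exp (- 2 * x)" by (simp only: exp_le_cancel_iff)
        then have E2: "2 * k * exp (- 2 * b * ln (cmod w)) \<le> exp (- 2 * x)"
          by (simp only: exp_add) (simp add: k_def)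
        have "k * exp (- 2 * b * ln (cmod w)) \<le> \<bar>exp (- 2 * g t) - exp (- 2 * x)\<bar>"
          using E1 E2 by linarith
        then have "ennreal (k * exp (- 2 * b * ln (cmod w))) \<le> D w"
          unfolding D_def t x(1) extend_minf_ereal ereal_exp_ereal by (simp add: ennreal_leI)
        then show "ennreal (k / (cmod w)\<^sup>2) \<le> G w"
          using k elim(4,5) by (intro G_lower) (auto simp: D_def)
      qed
    qed
    then obtain d where d: "d > 0" "\<And>w. w \<noteq> 0 \<Longrightarrow> cmod w < d \<Longrightarrow> ereal (\<kappa> * ln (cmod w)) < u w
        \<Longrightarrow> ennreal (k / (cmod w)\<^sup>2) \<le> G w"
      by (auto simp: eventually_at_0_cmod)
    obtain e where e: "e > 0" "ball 0 e \<subseteq> S" using S by (meson openE)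
    have [measurable]: "(\<lambda>z. if z \<in> S then u z else -\<infinity>) \<in> borel_measurable borel"
      using usc_on_borel_measurable[OF S(1), of u] sh by (simp add: subharmonic_on_def)
    have "\<forall>\<^sub>F w in at 0. u w \<le> ereal ((\<alpha> - \<epsilon>') * ln (cmod w))"
    proof (rule subharmonic_log_bound_off_sparse_set[OF sh S u_neg])
      show "0 < \<alpha> - \<epsilon>'" "\<alpha> - \<epsilon>' < \<kappa>" using \<epsilon>' \<alpha> by (auto simp: \<kappa>_def)
      fix \<theta> :: real assume "\<theta> > 0"
      from emeasure_le_of_integrable_inverse_square[OF G k this]
      obtain \<rho>0 where \<rho>0: "\<rho>0 > 0"
        "\<And>\<rho> X. \<lbrakk>0 < \<rho>; \<rho> \<le> \<rho>0; X \<in> sets borel; X \<subseteq> ball 0 \<rho> - {0}; \<And>w. w \<in> X \<Longrightarrow> ennreal (k / (cmod w)\<^sup>2) \<le> G w\<rbrakk>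
          \<Longrightarrow> emeasure lborel X \<le> ennreal (\<theta> * \<rho>\<^sup>2)" by metis
      show "\<exists>\<rho>0>0. \<forall>\<rho>. 0 < \<rho> \<and> \<rho> \<le> \<rho>0 \<longrightarrow>
         emeasure lborel {\<zeta> \<in> ball 0 \<rho> - {0}. ereal (\<kappa> * ln (cmod \<zeta>)) < u \<zeta>} \<le> ennreal (\<theta> * \<rho>\<^sup>2)"
      proof (intro exI[of _ "min \<rho>0 (min d e)"] conjI allI impI)
        show "0 < min \<rho>0 (min d e)" using \<rho>0 d e by simp
        fix \<rho> assume \<rho>: "0 < \<rho> \<and> \<rho> \<le> min \<rho>0 (min d e)"
        let ?X = "{\<zeta> \<in> ball 0 \<rho> - {0}. ereal (\<kappa> * ln (cmod \<zeta>)) < u \<zeta>}"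
        have eq: "?X = {\<zeta> \<in> space borel. ereal (\<kappa> * ln (cmod \<zeta>)) < (if \<zeta> \<in> S then u \<zeta> else -\<infinity>)} \<inter> (ball 0 \<rho> - {0})"
          using e \<rho> by force
        have "{\<zeta> \<in> space borel. ereal (\<kappa> * ln (cmod \<zeta>)) < (if \<zeta> \<in> S then u \<zeta> else -\<infinity>)} \<in> sets borel"
          by measurable
        then have X: "?X \<in> sets borel" unfolding eq by (rule sets.Int) auto
        show "emeasure lborel ?X \<le> ennreal (\<theta> * \<rho>\<^sup>2)"
        proof (rule \<rho>0(2)[OF _ _ X])
          fix w assume "w \<in> ?X"
          then show "ennreal (k / (cmod w)\<^sup>2) \<le> G w" using \<rho> by (intro d(2)) simp_all
        qed (use \<rho> in auto)
      qed
    qed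
    then show ?thesis using ev1
    proof eventually_elim
      case (elim w)
      have "(\<alpha> - \<epsilon>') * ln (cmod w) \<le> (\<alpha> - \<epsilon>) * ln (cmod w)"
        using elim \<epsilon>' by (intro mult_right_mono_neg) auto
      then show ?case using elim(1) by (meson ereal_less_eq(3) order_trans)
    qed
  qed
  obtain R where R: "R > 0" "cball 0 R \<subseteq> S" using S open_contains_cball by blast
  obtain C where C: "\<And>w. w \<noteq> 0 \<Longrightarrow> cmod w \<le> R \<Longrightarrow> u w \<le> ereal (\<alpha> * ln (cmod w) + C)"
    using removable_log_bound[OF sh R step1] by auto
  \<comment> \<open>With \<open>g(u) \<le> b ln \<bar>w\<bar> - M - 1\<close>, the first exponential is at least \<open>exp (2M + 2) \<bar>w\<bar>^(-2b)\<close>,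
    while the second one is at most \<open>exp (2M) \<bar>w\<bar>^(-2b)\<close>.\<close>
  define k where "k = exp (2 * M + 2) - exp (2 * M)"
  have k: "k > 0" by (simp add: k_def)
  have "\<forall>\<^sub>F t in at_bot. g t - C0 * t \<le> - M - 1 - C0 * C"
    using hbot by (simp add: filterlim_at_bot)
  from eventually_at_bot_scaled_ln[OF this \<alpha>(1), of C]
  have "\<forall>\<^sub>F w in at 0. g (\<alpha> * ln (cmod w) + C) \<le> b * ln (cmod w) - M - 1"
  proof eventually_elim
    case (elim w)
    have "C0 * (\<alpha> * ln (cmod w) + C) = b * ln (cmod w) + C0 * C"
      by (simp add: \<alpha>(2)[symmetric] algebra_simps)
    then show ?case using elim by linarith
  qed
  moreover have "\<forall>\<^sub>F w in at (0::complex). cmod w \<le> R"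
    using R(1) by (auto simp: eventually_at_0_cmod)
  ultimately have "\<forall>\<^sub>F w in at 0. ennreal (k / (cmod w)\<^sup>2) \<le> G w"
    using A GD ev1
  proof eventually_elim
    case (elim w)
    obtain x where x: "A w = ereal x" "\<bar>x - a * ln (cmod w)\<bar> \<le> M" using elim(3) by auto
    have uw: "u w \<le> ereal (\<alpha> * ln (cmod w) + C)" using elim by (intro C) auto
    have "ennreal (k * exp (- 2 * b * ln (cmod w))) \<le> D w"
    proof (cases "u w")
      case (real t)
      have "g t \<le> g (\<alpha> * ln (cmod w) + C)" using uw real by (intro monoD[OF mg]) simp
      then have "(2 * M + 2) + - 2 * b * ln (cmod w) \<le> - 2 * g t" using elim(1) by linarith
      then have "exp ((2 * M + 2) + - 2 * b * ln (cmod w)) \<le> exp (- 2 * g t)" by (simp only: exp_le_cancel_iff)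
      then have E1: "exp (2 * M + 2) * exp (- 2 * b * ln (cmod w)) \<le> exp (- 2 * g t)"
        by (simp only: exp_add)
      have "b * ln (cmod w) \<le> a * ln (cmod w)"
        using elim b by (intro mult_right_mono_neg) auto
      then have "- 2 * x \<le> 2 * M + - 2 * b * ln (cmod w)" using x(2) by (simp add: abs_le_iff)
      then have "exp (- 2 * x) \<le> exp (2 * M + - 2 * b * ln (cmod w))" by (simp only: exp_le_cancel_iff)
      then have E2: "exp (- 2 * x) \<le> exp (2 * M) * exp (- 2 * b * ln (cmod w))"
        by (simp only: exp_add)
      have "k * exp (- 2 * b * ln (cmod w)) \<le> \<bar>exp (- 2 * g t) - exp (- 2 * x)\<bar>"
        using E1 E2 unfolding k_def left_diff_distrib by linarith
      then show ?thesis
        unfolding D_def real x(1) extend_minf_ereal ereal_exp_ereal by (simp add: ennreal_leI)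
    next
      case MInf
      then show ?thesis
        unfolding D_def MInf x(1) extend_minf_MInf[OF gbot] ereal_exp_ereal ereal_exp_MInf by simp
    qed (use uw in simp)
    then show ?case using k elim(4,5) by (intro G_lower) (auto simp: D_def)
  qed
  then show False by (rule inverse_square_not_integrable[OF G k])
qed

section \<open>From the ball to a complex line\<close>

text \<open>Integrate the weighted line integrals over directions \<open>b\<close> with \<open>1 \<le> \<bar>b\<bar> \<le> 2\<close>. For fixed \<open>w\<close>, the
  substitution \<open>z = w b\<close> has Jacobian \<open>\<bar>w\<bar>^(2n)\<close>, which the weight cancels up to \<open>1 / \<bar>w\<bar>\<^sup>2\<close>; for
  fixed \<open>z\<close>, the admissible \<open>w\<close> fill the annulus \<open>\<bar>z\<bar> / 2 \<le> \<bar>w\<bar> \<le> \<bar>z\<bar>\<close>,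
  over which \<open>1 / \<bar>w\<bar>\<^sup>2\<close> has a bounded
  integral. So the total is at most a multiple of the integral of \<open>F\<close>.\<close>

lemma exists_line_finite_weighted_integral:
  fixes F :: "complex ^ 'n \<Rightarrow> ennreal"
  assumes F[measurable]: "F \<in> borel_measurable borel" and fin: "(\<integral>\<^sup>+z. F z \<partial>lborel) < \<infinity>"
  obtains b where "b \<noteq> 0" "norm b \<le> 2"
    "(\<integral>\<^sup>+w. ennreal (cmod w ^ (2 * CARD('n)) / (cmod w)\<^sup>2) * F (w *s b) \<partial>lborel) < \<infinity>"
proof -
  define N where "N = CARD('n)"
  define wt where "wt w = ennreal (cmod w ^ (2 * N) / (cmod w)\<^sup>2)" for w :: complex
  define B where "B = {b :: complex ^ 'n. 1 \<le> norm b \<and> norm b \<le> 2}"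
  have [measurable]: "(\<lambda>(w, b). w *s b) \<in> borel_measurable (borel :: (complex \<times> (complex ^ 'n)) measure)"
    by (intro borel_measurable_continuous_onI) (auto simp: case_prod_beta intro!: continuous_intros)
  then have [measurable]: "(\<lambda>(w, b). w *s b) \<in> (borel \<Otimes>\<^sub>M borel) \<rightarrow>\<^sub>M (borel :: (complex ^ 'n) measure)"
    by (simp add: borel_prod)
  have [measurable]: "B \<in> sets borel" "wt \<in> borel_measurable borel"
    unfolding B_def wt_def by (measurable; simp)+
  have pair: "(\<lambda>(w, b). F (w *s b)) \<in> borel_measurable (borel \<Otimes>\<^sub>M borel)"
    using measurable_compose[OF \<open>(\<lambda>(w, b). w *s b) \<in> (borel \<Otimes>\<^sub>M borel) \<rightarrow>\<^sub>M borel\<close> F]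
    by (simp add: case_prod_beta)
  define I where "I b = (\<integral>\<^sup>+w. wt w * F (w *s b) \<partial>lborel)" for b
  define k where "k z w = indicator {w. norm z / 2 \<le> cmod w \<and> cmod w \<le> norm z} w * ennreal (1 / (cmod w)\<^sup>2)"
    for z :: "complex ^ 'n" and w :: complex
  have kbound: "(\<integral>\<^sup>+w. k z w \<partial>lborel) \<le> ennreal (16 * pi)" if "z \<noteq> 0" for z
  proof -
    have "(\<integral>\<^sup>+w. k z w \<partial>lborel)
       \<le> (\<integral>\<^sup>+w. ennreal (4 / (norm z)\<^sup>2) * indicator (ball (0::complex) (2 * norm z)) w \<partial>lborel)"
    proof (rule nn_integral_mono)
      fix w
      show "k z w \<le> ennreal (4 / (norm z)\<^sup>2) * indicator (ball 0 (2 * norm z)) w"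
      proof (cases "norm z / 2 \<le> cmod w \<and> cmod w \<le> norm z")
        case True
        then have "(norm z / 2)\<^sup>2 \<le> (cmod w)\<^sup>2" by (intro power_mono) auto
        then have "1 / (cmod w)\<^sup>2 \<le> 1 / (norm z / 2)\<^sup>2" using that by (intro frac_le) auto
        also have "\<dots> = 4 / (norm z)\<^sup>2" by (simp add: power_divide)
        finally have "ennreal (1 / (cmod w)\<^sup>2) \<le> ennreal (4 / (norm z)\<^sup>2)" by (rule ennreal_leI)
        moreover have "cmod w < 2 * norm z" using True that by (smt (verit) zero_less_norm_iff)
        ultimately show ?thesis using True by (simp add: k_def)
      qed (simp add: k_def)
    qed
    also have "\<dots> = ennreal (4 / (norm z)\<^sup>2) * ennreal (pi * (2 * norm z)\<^sup>2)"
      by (subst nn_integral_cmult_indicator) (simp_all add: emeasure_ball unit_ball_vol_2)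
    also have "\<dots> = ennreal (16 * pi)"
      using that by (simp add: ennreal_mult[symmetric] power2_eq_square)
    finally show ?thesis .
  qed
  have inner: "(\<integral>\<^sup>+b. indicator B b * (wt w * F (w *s b)) \<partial>lborel)
      = (\<integral>\<^sup>+z. k z w * F z \<partial>lborel)" if w: "w \<noteq> 0" for w
  proof -
    have cw: "cmod w > 0" using w by simp
    define B' where "B' = {z :: complex ^ 'n. norm z / 2 \<le> cmod w \<and> cmod w \<le> norm z}"
    have [measurable]: "B' \<in> sets borel" unfolding B'_def by measurable
    have B': "indicator B b = (indicator B' (w *s b) :: ennreal)" for b
      using cw by (auto simp: B_def B'_def indicator_def norm_vector_scalar_mult_complex)
    have "(\<integral>\<^sup>+b. indicator B b * (wt w * F (w *s b)) \<partial>lborel)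
        = (\<integral>\<^sup>+b. wt w * (indicator B' (w *s b) * F (w *s b)) \<partial>lborel)"
      by (simp add: B' mult.left_commute)
    also have "\<dots> = ennreal ((1 / cmod w) ^ (2 * N)) * (\<integral>\<^sup>+z. wt w * (indicator B' z * F z) \<partial>lborel)"
      unfolding N_def by (rule nn_integral_complex_dilation[OF w]) measurable
    also have "\<dots> = (\<integral>\<^sup>+z. ennreal ((1 / cmod w) ^ (2 * N)) * (wt w * (indicator B' z * F z)) \<partial>lborel)"
      by (rule nn_integral_cmult[symmetric]) measurable
    also have "\<dots> = (\<integral>\<^sup>+z. k z w * F z \<partial>lborel)"
    proof (rule nn_integral_cong)
      fix z
      have "ennreal ((1 / cmod w) ^ (2 * N)) * wt w = ennreal (1 / (cmod w)\<^sup>2)"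
        using cw unfolding wt_def by (simp add: ennreal_mult[symmetric] power_one_over)
      moreover have "indicator B' z = (indicator {w. norm z / 2 \<le> cmod w \<and> cmod w \<le> norm z} w :: ennreal)"
        by (simp add: B'_def indicator_def)
      ultimately show "ennreal ((1 / cmod w) ^ (2 * N)) * (wt w * (indicator B' z * F z)) = k z w * F z"
        by (simp add: k_def mult.assoc[symmetric]) (simp add: mult_ac)
    qed
    finally show ?thesis .
  qed
  have kmeas: "(\<lambda>(w, z). k z w * F z) \<in> borel_measurable (lborel \<Otimes>\<^sub>M lborel)"
    unfolding k_def indicator_def by measurable
  have "(\<integral>\<^sup>+b. indicator B b * I b \<partial>lborel)
      = (\<integral>\<^sup>+b. (\<integral>\<^sup>+w. indicator B b * (wt w * F (w *s b)) \<partial>lborel) \<partial>lborel)"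
    unfolding I_def using pair
    by (intro nn_integral_cong nn_integral_cmult[symmetric]) measurable
  also have "\<dots> = (\<integral>\<^sup>+w. (\<integral>\<^sup>+b. indicator B b * (wt w * F (w *s b)) \<partial>lborel) \<partial>lborel)"
    by (rule lborel_pair.Fubini'[symmetric]) (use pair in measurable)
  also have "\<dots> = (\<integral>\<^sup>+w. (\<integral>\<^sup>+z. k z w * F z \<partial>lborel) \<partial>lborel)"
  proof (rule nn_integral_cong_AE)
    show "AE w in lborel. (\<integral>\<^sup>+b. indicator B b * (wt w * F (w *s b)) \<partial>lborel)
        = (\<integral>\<^sup>+z. k z w * F z \<partial>lborel)"
      using AE_lborel_singleton[of "0::complex"] by eventually_elim (rule inner)
  qed
  also have "\<dots> = (\<integral>\<^sup>+z. (\<integral>\<^sup>+w. k z w * F z \<partial>lborel) \<partial>lborel)"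
    by (rule lborel_pair.Fubini'[symmetric]) (use kmeas in simp)
  also have "\<dots> \<le> (\<integral>\<^sup>+z. ennreal (16 * pi) * F z \<partial>lborel)"
  proof (rule nn_integral_mono_AE)
    show "AE z in lborel. (\<integral>\<^sup>+w. k z w * F z \<partial>lborel) \<le> ennreal (16 * pi) * F z"
      using AE_lborel_singleton[of "0::complex ^ 'n"]
    proof eventually_elim
      case (elim z)
      have "(\<lambda>w. k z w) \<in> borel_measurable lborel" unfolding k_def indicator_def by measurable
      then have "(\<integral>\<^sup>+w. k z w * F z \<partial>lborel) = (\<integral>\<^sup>+w. k z w \<partial>lborel) * F z"
        by (rule nn_integral_multc)
      also have "\<dots> \<le> ennreal (16 * pi) * F z" by (intro mult_right_mono kbound elim) simp
      finally show ?case .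
    qed
  qed
  also have "\<dots> < \<infinity>" using fin by (simp add: nn_integral_cmult ennreal_mult_less_top)
  finally have finI: "(\<integral>\<^sup>+b. indicator B b * I b \<partial>lborel) < \<infinity>" .
  have Imeas: "I \<in> borel_measurable borel"
  proof -
    have "(\<lambda>(b, w). wt w * F (w *s b)) \<in> borel_measurable (borel \<Otimes>\<^sub>M lborel)"
      using measurable_compose[OF measurable_pair_swap' pair] by (simp add: case_prod_beta)
    then show ?thesis unfolding I_def by (rule lborel.borel_measurable_nn_integral)
  qed
  have "emeasure lborel B \<noteq> 0"
  proof -
    have "ball (0 :: complex ^ 'n) 2 - ball 0 1 \<subseteq> B" by (auto simp: B_def)
    then have "emeasure lborel (ball (0 :: complex ^ 'n) 2 - ball 0 1) \<le> emeasure lborel B"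
      by (intro emeasure_mono) auto
    moreover have "emeasure lborel (ball (0 :: complex ^ 'n) 2 - ball 0 1)
        = emeasure lborel (ball (0 :: complex ^ 'n) 2) - emeasure lborel (ball (0 :: complex ^ 'n) 1)"
      by (rule emeasure_Diff) (auto simp: emeasure_ball)
    moreover have "emeasure lborel (ball (0 :: complex ^ 'n) 1) < emeasure lborel (ball (0 :: complex ^ 'n) 2)"
      by (simp add: emeasure_ball ennreal_less_iff unit_ball_vol_pos unit_ball_vol_nonneg)
    ultimately show ?thesis by (auto simp: diff_eq_0_iff_ennreal not_less[symmetric])
  qed
  have "\<exists>b\<in>B. I b < \<infinity>"
  proof (rule ccontr)
    assume "\<not> ?thesis"
    then have "indicator B b * I b = \<infinity> * indicator B b" for b
      by (auto simp: indicator_def less_top[symmetric])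
    then have "(\<integral>\<^sup>+b. indicator B b * I b \<partial>lborel) = \<infinity> * emeasure lborel B"
      by (simp add: nn_integral_cmult)
    then show False using finI \<open>emeasure lborel B \<noteq> 0\<close> by (simp add: ennreal_top_mult)
  qed
  then obtain b where "b \<in> B" "I b < \<infinity>" by auto
  then show ?thesis by (intro that[of b]) (auto simp: B_def I_def wt_def N_def)
qed

text \<open>Passing from \<open>\<bar>w b\<bar>\<close> to \<open>\<bar>w\<bar>\<close> shifts the logarithm by a constant, which half of \<open>\<epsilon>\<close> absorbs.\<close>

lemma lelong_number_log_bound:
  fixes \<phi> :: "complex ^ 'n \<Rightarrow> ereal"
  assumes C0: "C0 > 0" and lel: "ereal C0 * lelong_number \<phi> 0 \<ge> ereal (real n)"
    and b: "b \<noteq> 0" and \<epsilon>: "\<epsilon> > 0"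
  shows "\<forall>\<^sub>F w in at 0. \<phi> (w *s b) \<le> ereal ((n / C0 - \<epsilon>) * ln (cmod w))"
proof -
  have "ereal (n / C0 - \<epsilon> / 2) < ereal (n / C0)" using \<epsilon> by simp
  also have "ereal (n / C0) \<le> lelong_number \<phi> 0"
    using lel C0 by (cases "lelong_number \<phi> 0") (auto simp: field_simps)
  finally have "\<forall>\<^sub>F z in at 0. ereal (n / C0 - \<epsilon> / 2) < \<phi> z / ereal (ln (norm z))"
    unfolding lelong_number_def by (auto dest!: less_LiminfD)
  then obtain d where d: "d > 0"
    "\<And>z. z \<noteq> 0 \<Longrightarrow> norm z < d \<Longrightarrow> ereal (n / C0 - \<epsilon> / 2) < \<phi> z / ereal (ln (norm z))"
    by (auto simp: eventually_at)
  have nb: "norm b > 0" using b by simp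
  have "\<forall>\<^sub>F w in at (0::complex). w \<noteq> 0 \<and> cmod w < min d 1 / norm b"
    using d nb by (auto simp: eventually_at_0_cmod intro!: exI[of _ "min d 1 / norm b"])
  then show ?thesis
    using eventually_ln_cmod_le[of "- 2 * \<bar>n / C0 - \<epsilon> / 2\<bar> * \<bar>ln (norm b)\<bar> / \<epsilon>"]
  proof eventually_elim
    case (elim w)
    define c where "c = n / C0 - \<epsilon> / 2"
    have nz: "norm (w *s b) = cmod w * norm b" by (rule norm_vector_scalar_mult_complex)
    have small: "cmod w * norm b < d" "cmod w * norm b < 1" "cmod w * norm b > 0"
      using elim(1) nb by (simp_all add: pos_less_divide_eq)
    then have "w *s b \<noteq> 0" by (metis nz norm_zero less_irrefl)
    with d(2)[of "w *s b"] small have lt: "ereal c < \<phi> (w *s b) / ereal (ln (cmod w * norm b))"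
      by (simp add: nz c_def)
    have lneg: "ln (cmod w * norm b) < 0" using small by simp
    have "\<phi> (w *s b) \<le> ereal (c * ln (cmod w * norm b))"
      using lt lneg by (cases "\<phi> (w *s b)") (auto simp: neg_less_divide_eq)
    also have "c * ln (cmod w * norm b) \<le> (n / C0 - \<epsilon>) * ln (cmod w)"
    proof -
      have "\<epsilon> / 2 * ln (cmod w) \<le> - (\<bar>c\<bar> * \<bar>ln (norm b)\<bar>)"
        using elim(2) \<epsilon> by (simp add: c_def field_simps)
      also have "\<dots> \<le> - (c * ln (norm b))"
        by (metis abs_ge_self abs_mult neg_le_iff_le)
      finally have "c * ln (norm b) + \<epsilon> / 2 * ln (cmod w) \<le> 0" by simp
      moreover have "ln (cmod w * norm b) = ln (cmod w) + ln (norm b)"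
        using elim(1) nb by (simp add: ln_mult)
      ultimately show ?thesis by (simp add: c_def algebra_simps)
    qed
    finally show ?case by simp
  qed
qed

lemma extend_minf_borel_measurable:
  assumes "convex_on UNIV g"
  shows "extend_minf g \<in> borel_measurable borel"
proof -
  have "continuous_on UNIV g" using assms by (intro convex_on_continuous) auto
  then have [measurable]: "g \<in> borel_measurable borel" by (rule borel_measurable_continuous_onI)
  show ?thesis unfolding extend_minf_def by measurable
qed

lemma ereal_exp_borel_measurable: "ereal_exp \<in> borel_measurable borel"
  unfolding ereal_exp_def by measurable

theorem theorem1p2:
  fixes g :: "real \<Rightarrow> real"
    and C0 :: real
    and U :: "(complex ^ 'n) set"
    and \<phi> \<phi>A :: "complex ^ 'n \<Rightarrow> ereal"
  assumes "convex_on UNIV g"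
    and "mono g"
    and "deriv_tendsto_at_bot g C0"
    and "C0 > 0"
    and "open U" and "0 \<in> U"
    and "psh_on U \<phi>"
    and "ereal C0 * lelong_number \<phi> 0 \<ge> ereal (real CARD('n))"
    and "\<phi>A \<in> gen_analytic_psh UNIV"
    and "locally_integrable_near
           (\<lambda>z. ereal_exp (- 2 * extend_minf g (\<phi> z)) - ereal_exp (- 2 * \<phi>A z)) 0"
  shows "\<exists>l::real. ((\<lambda>t. \<bar>g t - C0 * t\<bar>) \<longlongrightarrow> l) at_bot"
  using mono_at_bot_cases[OF convex_minus_asymptote_mono[OF assms(1,3)]]
proof
  assume "\<exists>l. ((\<lambda>t. g t - C0 * t) \<longlongrightarrow> l) at_bot"
  then show ?thesis using tendsto_rabs by blast
next
  assume hbot: "filterlim (\<lambda>t. g t - C0 * t) at_bot at_bot"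
  have gbot: "filterlim g at_bot at_bot"
    unfolding filterlim_at_bot
  proof
    fix Z
    have "\<forall>\<^sub>F t in at_bot. g t - C0 * t \<le> Z" using hbot by (simp add: filterlim_at_bot)
    then show "\<forall>\<^sub>F t in at_bot. g t \<le> Z"
      using eventually_le_at_bot[of "0::real"]
    proof eventually_elim
      case (elim t)
      then show ?case using mult_nonneg_nonpos[of C0 t] assms(4) by simp
    qed
  qed
  define f where "f z = ereal_exp (- 2 * extend_minf g (\<phi> z)) - ereal_exp (- 2 * \<phi>A z)" for z
  obtain V where V: "open V" "0 \<in> V" and fin: "(\<integral>\<^sup>+ z. e2ennreal \<bar>f z\<bar> \<partial>lebesgue_on V) < \<infinity>"
    using assms(10) unfolding locally_integrable_near_def f_def by blast
  obtain r0 where r0: "r0 > 0" "ball 0 r0 \<subseteq> U \<inter> V"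
    using openE[of "U \<inter> V" 0] V assms(5,6) by auto
  have pshA: "psh_on UNIV \<phi>A" using assms(9) by (simp add: gen_analytic_psh_def)
  define \<phi>' where "\<phi>' z = (if z \<in> U then \<phi> z else -\<infinity>)" for z
  have [measurable]: "\<phi>' \<in> borel_measurable borel"
    unfolding \<phi>'_def[abs_def] using assms(5,7) by (intro usc_on_borel_measurable) (auto simp: psh_on_def)
  have [measurable]: "\<phi>A \<in> borel_measurable borel"
    using usc_on_borel_measurable[of UNIV \<phi>A] pshA by (simp add: psh_on_def)
  note [measurable] = extend_minf_borel_measurable[OF assms(1)] ereal_exp_borel_measurable
  define F where "F z = e2ennreal \<bar>ereal_exp (- 2 * extend_minf g (\<phi>' z)) - ereal_exp (- 2 * \<phi>A z)\<bar>
      * indicator (ball 0 r0) z" for z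
  have [measurable]: "ball (0 :: complex ^ 'n) r0 \<in> sets borel" by simp
  have F[measurable]: "F \<in> borel_measurable borel" unfolding F_def by measurable
  have Ff: "F z = e2ennreal \<bar>f z\<bar>" if "z \<in> ball 0 r0" for z
    using that r0 by (auto simp: F_def f_def \<phi>'_def)
  have "(\<integral>\<^sup>+z. F z \<partial>lborel) = (\<integral>\<^sup>+z. F z \<partial>lebesgue)" by (simp add: nn_integral_completion)
  also have "\<dots> \<le> (\<integral>\<^sup>+z. e2ennreal \<bar>f z\<bar> * indicator V z \<partial>lebesgue)"
  proof (rule nn_integral_mono)
    fix z
    show "F z \<le> e2ennreal \<bar>f z\<bar> * indicator V z"
    proof (cases "z \<in> ball 0 r0")
      case True
      then show ?thesis using Ff[OF True] r0 by (auto simp: indicator_def)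
    qed (simp add: F_def)
  qed
  also have "\<dots> = (\<integral>\<^sup>+ z. e2ennreal \<bar>f z\<bar> \<partial>lebesgue_on V)"
    using V(1) by (subst nn_integral_restrict_space) auto
  finally have finF: "(\<integral>\<^sup>+z. F z \<partial>lborel) < \<infinity>" using fin by simp
  obtain b where b: "b \<noteq> 0" "norm b \<le> 2" and
    finb: "(\<integral>\<^sup>+w. ennreal (cmod w ^ (2 * CARD('n)) / (cmod w)\<^sup>2) * F (w *s b) \<partial>lborel) < \<infinity>"
    by (rule exists_line_finite_weighted_integral[OF F finF])
  define G where "G w = ennreal (cmod w ^ (2 * CARD('n)) / (cmod w)\<^sup>2) * F (w *s b)" for w
  have line: "line_param 0 b w = w *s b" for w by (simp add: line_param_def)
  have cont: "continuous_on UNIV (\<lambda>w. w *s b)" by (intro continuous_intros)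
  then have [measurable]: "(\<lambda>w. w *s b) \<in> borel_measurable borel" by (rule borel_measurable_continuous_onI)
  have G: "G \<in> borel_measurable borel" "(\<integral>\<^sup>+w. G w \<partial>lborel) < \<infinity>"
    unfolding G_def by (measurable) (rule finb)
  have near: "\<forall>\<^sub>F w in at 0. w \<noteq> 0 \<and> w *s b \<in> ball 0 r0"
  proof -
    have "\<forall>\<^sub>F w in at (0::complex). w \<noteq> 0 \<and> cmod w < r0 / norm b"
      using r0 b by (auto simp: eventually_at_0_cmod intro!: exI[of _ "r0 / norm b"])
    then show ?thesis
      by eventually_elim (use b in \<open>simp add: norm_vector_scalar_mult_complex field_simps\<close>)
  qed
  define S where "S = line_param 0 b -` U"
  have sh: "subharmonic_on S (\<phi> \<circ> line_param 0 b)"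
    using assms(7) b(1) by (simp add: psh_on_def S_def)
  have S: "open S" "0 \<in> S"
    using open_vimage[OF assms(5) cont] assms(6) by (simp_all add: S_def line_param_def vimage_def)
  obtain r where r: "r > 0"
    "analytic_singularities_on (line_param 0 b -` ball 0 r) (\<phi>A \<circ> line_param 0 b)"
    using assms(9) b(1) unfolding gen_analytic_psh_def by blast
  have "0 \<in> line_param 0 b -` ball 0 r" using r(1) by (simp add: line)
  from analytic_singularity_log_form[OF r(2) this] show ?thesis
  proof
    assume "\<forall>\<^sub>F w in at 0. (\<phi>A \<circ> line_param 0 b) w = -\<infinity>"
    with near have "\<forall>\<^sub>F w in at 0. ennreal (1 / (cmod w)\<^sup>2) \<le> G w"
    proof eventually_elim
      case (elim w)
      \<comment> \<open>This includes \<open>x = \<infinity>\<close>, where the convention \<open>\<infinity> - \<infinity> = \<infinity>\<close> enters.\<close>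
      have "\<bar>x - (\<infinity>::ereal)\<bar> = \<infinity>" for x by (cases x) auto
      then have "F (w *s b) = \<infinity>" using elim Ff[of "w *s b"] by (simp add: f_def line ereal_exp_def)
      then have "G w = \<infinity>" using elim by (simp add: G_def ennreal_mult_top)
      then show ?case by simp
    qed
    then show ?thesis using inverse_square_not_integrable[OF G zero_less_one] by blast
  next
    assume "\<exists>a M. \<forall>\<^sub>F w in at 0. \<exists>x. (\<phi>A \<circ> line_param 0 b) w = ereal x \<and> \<bar>x - a * ln (cmod w)\<bar> \<le> M"
    then obtain a M where A: "\<forall>\<^sub>F w in at 0. \<exists>x. (\<phi>A \<circ> line_param 0 b) w = ereal x \<and> \<bar>x - a * ln (cmod w)\<bar> \<le> M"
      by blast
    have "CARD('n) \<ge> 1" by (simp add: Suc_leI)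
    moreover have "\<forall>\<^sub>F w in at 0. (\<phi> \<circ> line_param 0 b) w \<le> ereal ((real CARD('n) / C0 - \<epsilon>) * ln (cmod w))"
      if "\<epsilon> > 0" for \<epsilon>
      using lelong_number_log_bound[OF assms(4,8) b(1) that] by (simp add: line)
    moreover from near have "\<forall>\<^sub>F w in at 0. ennreal (cmod w ^ (2 * CARD('n)) / (cmod w)\<^sup>2)
       * e2ennreal \<bar>ereal_exp (- 2 * extend_minf g ((\<phi> \<circ> line_param 0 b) w))
           - ereal_exp (- 2 * (\<phi>A \<circ> line_param 0 b) w)\<bar> \<le> G w"
      by eventually_elim (simp add: G_def Ff f_def line)
    ultimately have False
      by (rule line_comparison_contradiction[OF assms(1-4) hbot gbot sh S _ _ A G])
    then show ?thesis ..
  qed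
qed

end
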